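(* Let $p$ be a prime, $r\ge1$, and let $\mathcal C$ be a convolutional code over $\mathbb Z_{p^r}$ of length $n$ and $p$-dimension $k$. Assume that $\mathcal C$ has a generator matrix $$\widetilde G(D)=\begin{bmatrix}\widetilde{\mathcal G}_0(D)\\ p\,\widetilde{\mathcal G}_1(D)\\ \vdots\\ p^{r-1}\widetilde{\mathcal G}_{r-1}(D)\end{bmatrix}$$ with polynomial blocks $\widetilde{\mathcal G}_i(D)$ over $\mathbb Z_{p^r}[D]$ (some possibly empty) such that the matrix $\widehat G(D)$ obtained by stacking $\widetilde{\mathcal G}_0(D),\dots,\widetilde{\mathcal G}_{r-1}(D)$ is full row rank and $\widehat G(0)$ is full row rank. Then, for every $j\in\mathbb N_0$, $$d^c_j(\mathcal C)\le\Bigl(n-\Bigl\lceil\frac kr\Bigr\rceil\Bigr)(j+1)+1 .$$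
   Context: Notation: $\mathcal A_p=\{0,1,\dots,p-1\}\subset\mathbb Z_{p^r}$; $\mathbb Z_{p^r}((D))$ is the ring of formal Laurent series; $\mathcal A_p((D))$ and $\mathcal A_p[D]$ are the sets of Laurent series and polynomials with coefficients in $\mathcal A_p$. A matrix over $\mathbb Z_{p^r}$ or over $\mathbb Z_{p^r}[D]$ is full row rank if its rows are linearly independent over $\mathbb Z_{p^r}$, respectively over $\mathbb Z_{p^r}((D))$. A $p$-linear combination of $v_1,\dots,v_k\in\mathbb Z_{p^r}^n[D]$ is a sum $\sum_j a_jv_j$ with $a_j\in\mathcal A_p[D]$. For vectors in $\mathbb Z_{p^r}^n$ the coefficients are taken in $\mathcal A_p$. An ordered set $(v_1,\dots,v_k)$ is a $p$-generator sequence if $p v_i$ is a $p$-linear combination of $v_{i+1},\dots,v_k$ for $i=1,\dots,k-1$, and $p v_k=0$. Vectors are $p$-linearly independent if the only $p$-linear combination of them equal to $0$ is the trivial one. A $p$-basis is a $p$-generator sequence whose vectors are $p$-linearly independent. A convolutional code $\mathcal C$ of length $n$ over $\mathbb Z_{p^r}$ is a $\mathbb Z_{p^r}((D))$-submodule of $\mathbb Z_{p^r}^n((D))$ of the form $\{u(D)\widetilde G(D):u(D)\in\mathbb Z_{p^r}^{\widetilde k}((D))\}$ for some polynomial matrix $\widetilde G(D)\in\mathbb Z_{p^r}^{\widetilde k\times n}[D]$, called a generator matrix of $\mathcal C$. A $p$-encoder of $\mathcal C$ is a matrix $G(D)\in\mathbb Z_{p^r}^{k\times n}[D]$ whose rows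 form a $p$-basis and such that $\mathcal C=\{u(D)G(D):u(D)\in\mathcal A_p^k((D))\}$; then $k$ is the $p$-dimension of $\mathcal C$. A $p$-encoder is delay-free if for all $u(D)\in\mathcal A_p^k((D))$ and $N\in\mathbb Z$, $\operatorname{supp}(u(D)G(D))\subset[N,\infty)$ implies $\operatorname{supp}(u(D))\subset[N,\infty)$ (equivalently, the rows of $G(0)$ are $p$-linearly independent). Every convolutional code admits a delay-free $p$-encoder. Column distance: $\operatorname{wt}$ denotes Hamming weight (number of nonzero entries), and for $v(D)=\sum_i v_iD^i$, $\operatorname{wt}(v(D))=\sum_i \operatorname{wt}(v_i)$ and $v(D)|_{[0,j]}=\sum_{i=0}^{j}v_iD^i$. For a delay-free $p$-encoder $G(D)$ of $\mathcal C$, $$d^c_j(\mathcal C)=\min\{\operatorname{wt}(v(D)|_{[0,j]}): v(D)=u(D)G(D),\ u(D)=\sum_{i\ge0}u_iD^i\in\mathcal A_p^k((D)),\ u_0\ne0\},$$ which does not depend on the choice of delay-free $p$-encoder. *)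

theory Defs
  imports
    "HOL-Computational_Algebra.Formal_Laurent_Series"
    "HOL-Computational_Algebra.Polynomial_FPS"
    "Jordan_Normal_Form.Matrix"
    "Berlekamp_Zassenhaus.Finite_Field"
begin

text \<open>
  The ring of integers modulo \<open>p ^ r\<close> is \<open>'q mod_ring\<close> with \<open>CARD('q) = p ^ r\<close>. The definitions
  below make sense for every commutative ring \<open>'a\<close>; vectors are row vectors.
\<close>

section \<open>Row vectors and matrices\<close>

definition vec_mat_mult :: "'a :: comm_ring_1 vec \<Rightarrow> 'a mat \<Rightarrow> 'a vec" (infixl \<open>\<^sub>v*\<close> 70) where
  "u \<^sub>v* A = transpose_mat A *\<^sub>v u"

definition vstack :: "nat \<Rightarrow> 'a mat list \<Rightarrow> 'a mat" where
  "vstack n As = mat_of_rows n (concat (map rows As))"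

definition full_row_rank :: "'a :: comm_ring_1 mat \<Rightarrow> bool" where
  "full_row_rank A \<longleftrightarrow>
     (\<forall>u \<in> carrier_vec (dim_row A). u \<^sub>v* A = 0\<^sub>v (dim_col A) \<longrightarrow> u = 0\<^sub>v (dim_row A))"

abbreviation fls_of_poly :: "'a :: zero poly \<Rightarrow> 'a fls" where
  "fls_of_poly f \<equiv> fps_to_fls (fps_of_poly f)"

abbreviation laurent_mat :: "'a :: zero poly mat \<Rightarrow> 'a fls mat" where
  "laurent_mat G \<equiv> map_mat fls_of_poly G"

abbreviation eval0_mat :: "'a :: comm_semiring_0 poly mat \<Rightarrow> 'a mat" where
  "eval0_mat G \<equiv> map_mat (\<lambda>f. poly f 0) G"

section \<open>\<open>p\<close>-linear combinations and \<open>p\<close>-bases\<close>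

definition digits :: "nat \<Rightarrow> 'a :: comm_ring_1 set" where
  "digits p = of_nat ` {..<p}"

definition digit_polys :: "nat \<Rightarrow> 'a :: comm_ring_1 poly set" where
  "digit_polys p = {f. \<forall>i. poly.coeff f i \<in> digits p}"

definition digit_laurent :: "nat \<Rightarrow> 'a :: comm_ring_1 fls set" where
  "digit_laurent p = {f. \<forall>i. fls_nth f i \<in> digits p}"

definition vecs_over :: "'a set \<Rightarrow> nat \<Rightarrow> 'a vec set" where
  "vecs_over S k = {u \<in> carrier_vec k. set\<^sub>v u \<subseteq> S}"

definition p_span :: "nat \<Rightarrow> nat \<Rightarrow> 'a :: comm_ring_1 poly vec list \<Rightarrow> 'a poly vec set" where
  "p_span p n vs = {a \<^sub>v* mat_of_rows n vs | a. a \<in> vecs_over (digit_polys p) (length vs)}"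

definition p_generator_sequence :: "nat \<Rightarrow> nat \<Rightarrow> 'a :: comm_ring_1 poly vec list \<Rightarrow> bool" where
  "p_generator_sequence p n vs \<longleftrightarrow>
     set vs \<subseteq> carrier_vec n \<and>
     (\<forall>i. Suc i < length vs \<longrightarrow> of_nat p \<cdot>\<^sub>v vs ! i \<in> p_span p n (drop (Suc i) vs)) \<and>
     (vs \<noteq> [] \<longrightarrow> of_nat p \<cdot>\<^sub>v last vs = 0\<^sub>v n)"

definition p_lin_indep :: "nat \<Rightarrow> nat \<Rightarrow> 'a :: comm_ring_1 poly vec list \<Rightarrow> bool" where
  "p_lin_indep p n vs \<longleftrightarrow>
     (\<forall>a \<in> vecs_over (digit_polys p) (length vs).
        a \<^sub>v* mat_of_rows n vs = 0\<^sub>v n \<longrightarrow> a = 0\<^sub>v (length vs))"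

definition p_basis :: "nat \<Rightarrow> nat \<Rightarrow> 'a :: comm_ring_1 poly vec list \<Rightarrow> bool" where
  "p_basis p n vs \<longleftrightarrow> p_generator_sequence p n vs \<and> p_lin_indep p n vs"

section \<open>Convolutional codes\<close>

definition generator_matrix ::
    "nat \<Rightarrow> 'a :: comm_ring_1 fls vec set \<Rightarrow> 'a poly mat \<Rightarrow> bool" where
  "generator_matrix n C G \<longleftrightarrow>
     dim_col G = n \<and> C = {u \<^sub>v* laurent_mat G | u. u \<in> carrier_vec (dim_row G)}"

definition convolutional_code :: "nat \<Rightarrow> 'a :: comm_ring_1 fls vec set \<Rightarrow> bool" where
  "convolutional_code n C \<longleftrightarrow> (\<exists>G. generator_matrix n C G)"

definition p_encoder ::
    "nat \<Rightarrow> nat \<Rightarrow> 'a :: comm_ring_1 fls vec set \<Rightarrow> 'a poly mat \<Rightarrow> bool" where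
  "p_encoder p n C G \<longleftrightarrow>
     dim_col G = n \<and> p_basis p n (rows G) \<and>
     C = {u \<^sub>v* laurent_mat G | u. u \<in> vecs_over (digit_laurent p) (dim_row G)}"

definition has_p_dimension :: "nat \<Rightarrow> nat \<Rightarrow> 'a :: comm_ring_1 fls vec set \<Rightarrow> nat \<Rightarrow> bool" where
  "has_p_dimension p n C k \<longleftrightarrow> (\<exists>G. p_encoder p n C G \<and> dim_row G = k)"

definition coeff_vec :: "'a :: zero fls vec \<Rightarrow> int \<Rightarrow> 'a vec" where
  "coeff_vec v i = map_vec (\<lambda>f. fls_nth f i) v"

definition supp :: "'a :: zero fls vec \<Rightarrow> int set" where
  "supp v = {i. coeff_vec v i \<noteq> 0\<^sub>v (dim_vec v)}"

definition delay_free :: "nat \<Rightarrow> 'a :: comm_ring_1 poly mat \<Rightarrow> bool" where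
  "delay_free p G \<longleftrightarrow>
     (\<forall>u \<in> vecs_over (digit_laurent p) (dim_row G). \<forall>N.
        supp (u \<^sub>v* laurent_mat G) \<subseteq> {N..} \<longrightarrow> supp u \<subseteq> {N..})"

section \<open>Column distances\<close>

definition hamming_weight :: "'a :: zero vec \<Rightarrow> nat" where
  "hamming_weight v = card {i. i < dim_vec v \<and> vec_index v i \<noteq> 0}"

text \<open>The weight of the truncation of \<open>v\<close> to the degrees \<open>0, \<dots>, j\<close>.\<close>

definition truncated_weight :: "nat \<Rightarrow> 'a :: zero fls vec \<Rightarrow> nat" where
  "truncated_weight j v = (\<Sum>i = 0..j. hamming_weight (coeff_vec v (int i)))"

text \<open>
  For an encoder with at least one row the set of weights is nonempty and the infimum is a minimum.
  For the zero code there is no admissible \<open>u\<close>; its column distances are set to 0.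
\<close>

definition encoder_column_distance :: "nat \<Rightarrow> 'a :: comm_ring_1 poly mat \<Rightarrow> nat \<Rightarrow> nat" where
  "encoder_column_distance p G j =
     (let W = {truncated_weight j (u \<^sub>v* laurent_mat G) | u.
                 u \<in> vecs_over (digit_laurent p) (dim_row G) \<and> supp u \<subseteq> {0..} \<and>
                 coeff_vec u 0 \<noteq> 0\<^sub>v (dim_row G)}
      in if W = {} then 0 else Inf W)"

definition column_distance :: "nat \<Rightarrow> nat \<Rightarrow> 'a :: comm_ring_1 fls vec set \<Rightarrow> nat \<Rightarrow> nat" where
  "column_distance p n C j =
     encoder_column_distance p (SOME G. p_encoder p n C G \<and> delay_free p G) j"

text \<open>The column distance does not depend on the choice of the delay-free \<open>p\<close>-encoder.\<close>

lemma supp_subset_iff: "supp v \<subseteq> {N..} \<longleftrightarrow> (\<forall>c < dim_vec v. \<forall>i < N. fls_nth (vec_index v c) i = 0)"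
proof -
  have "supp v \<subseteq> {N..} \<longleftrightarrow> (\<forall>i < N. coeff_vec v i = 0\<^sub>v (dim_vec v))"
    unfolding supp_def by (auto simp: not_le subset_iff)
  also have "\<dots> \<longleftrightarrow> (\<forall>i < N. \<forall>c < dim_vec v. fls_nth (vec_index v c) i = 0)"
    by (auto simp: coeff_vec_def vec_eq_iff)
  finally show ?thesis by blast
qed

lemma fls_mult_fps_low:
  fixes f :: "'a :: comm_ring_1 fls"
  assumes "\<forall>i < N. fls_nth f i = 0" "i < N"
  shows "fls_nth (fps_to_fls g * f) i = 0"
proof (cases "fps_to_fls g * f = 0")
  case False
  then have "f \<noteq> 0" by auto
  then have "N \<le> fls_subdegree f"
    using assms(1) by (intro fls_subdegree_geI) auto
  moreover have "fls_subdegree (fps_to_fls g) + fls_subdegree f \<le> fls_subdegree (fps_to_fls g * f)"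
    using False by (rule fls_mult_subdegree_ge)
  moreover have "0 \<le> fls_subdegree (fps_to_fls g)"
    by (rule fls_subdegree_fls_to_fps_gt0)
  ultimately show ?thesis
    using assms(2) by (intro fls_eq0_below_subdegree) simp
qed simp

lemma supp_vec_mat_mult:
  assumes "u \<in> carrier_vec (dim_row G)" "supp u \<subseteq> {N..}"
  shows "supp (u \<^sub>v* laurent_mat G) \<subseteq> {N..}"
  unfolding supp_subset_iff
proof (intro allI impI)
  fix c i assume c: "c < dim_vec (u \<^sub>v* laurent_mat G)" and i: "i < N"
  then have c': "c < dim_col G" by (simp add: vec_mat_mult_def)
  have "vec_index (u \<^sub>v* laurent_mat G) c =
      (\<Sum>l = 0..<dim_row G. fls_of_poly (index_mat G (l, c)) * vec_index u l)"
    using c' assms(1) by (auto simp: vec_mat_mult_def scalar_prod_def intro!: sum.cong)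
  moreover have "fls_nth (fls_of_poly (index_mat G (l, c)) * vec_index u l) i = 0"
    if "l < dim_row G" for l
    using assms that i by (intro fls_mult_fps_low[of N]) (auto simp: supp_subset_iff)
  ultimately show "fls_nth (vec_index (u \<^sub>v* laurent_mat G) c) i = 0"
    by (simp add: fls_nth_sum)
qed

lemma supp_start_iff:
  "supp v \<subseteq> {0..} \<and> coeff_vec v 0 \<noteq> 0\<^sub>v (dim_vec v) \<longleftrightarrow> supp v \<subseteq> {0..} \<and> \<not> supp v \<subseteq> {1..}"
proof -
  have "supp v \<subseteq> {1..} \<longleftrightarrow> 0 \<notin> supp v" if "supp v \<subseteq> {0..}"
  proof
    assume "0 \<notin> supp v"
    show "supp v \<subseteq> {1..}"
    proof
      fix x assume "x \<in> supp v"
      then have "x \<noteq> 0" "x \<ge> 0" using that \<open>0 \<notin> supp v\<close> by (metis, auto)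
      then show "x \<in> {1..}" by simp
    qed
  qed auto
  then show ?thesis by (auto simp: supp_def)
qed

lemma encoder_column_distance_code:
  assumes "p_encoder p n C G" "delay_free p G"
  shows "encoder_column_distance p G j =
     (let W = {truncated_weight j v | v. v \<in> C \<and> supp v \<subseteq> {0..} \<and> \<not> supp v \<subseteq> {1..}}
      in if W = {} then 0 else Inf W)"
proof -
  have C: "C = {u \<^sub>v* laurent_mat G | u. u \<in> vecs_over (digit_laurent p) (dim_row G)}"
    using assms(1) by (simp add: p_encoder_def)
  have *: "supp u \<subseteq> {N..} \<longleftrightarrow> supp (u \<^sub>v* laurent_mat G) \<subseteq> {N..}"
    if "u \<in> vecs_over (digit_laurent p) (dim_row G)" for u N
    using that assms(2) supp_vec_mat_mult[of u G N]
    by (auto simp: delay_free_def vecs_over_def)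
  have **: "supp u \<subseteq> {0..} \<and> coeff_vec u 0 \<noteq> 0\<^sub>v (dim_row G) \<longleftrightarrow>
      supp (u \<^sub>v* laurent_mat G) \<subseteq> {0..} \<and> \<not> supp (u \<^sub>v* laurent_mat G) \<subseteq> {1..}"
    if "u \<in> vecs_over (digit_laurent p) (dim_row G)" for u
    using supp_start_iff[of u] *[OF that] that by (auto simp: vecs_over_def)
  have "{truncated_weight j (u \<^sub>v* laurent_mat G) | u.
                 u \<in> vecs_over (digit_laurent p) (dim_row G) \<and> supp u \<subseteq> {0..} \<and>
                 coeff_vec u 0 \<noteq> 0\<^sub>v (dim_row G)}
      = {truncated_weight j v | v. v \<in> C \<and> supp v \<subseteq> {0..} \<and> \<not> supp v \<subseteq> {1..}}"
    unfolding C using ** by blast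
  then show ?thesis by (simp add: encoder_column_distance_def)
qed

lemma column_distance_eq:
  assumes "p_encoder p n C G" "delay_free p G"
  shows "column_distance p n C j = encoder_column_distance p G j"
proof -
  define H where "H = (SOME G. p_encoder p n C G \<and> delay_free p G)"
  have "p_encoder p n C H" "delay_free p H"
    using someI[of "\<lambda>G. p_encoder p n C G \<and> delay_free p G" G] assms by (auto simp: H_def)
  then have "encoder_column_distance p H j = encoder_column_distance p G j"
    by (simp only: encoder_column_distance_code[OF assms] encoder_column_distance_code)
  then show ?thesis
    by (simp only: column_distance_def H_def)
qed

end

theory Submission
  imports Defs "Jordan_Normal_Form.Determinant"
begin

text \<open>
  Write \<open>R\<close> for the ring of integers modulo \<open>p ^ r\<close>, let \<open>G\<close> be the stack of the blocks \<open>B i\<close> and \<open>K\<close>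
  the number of its rows \<open>g\<^sub>l\<close>, and let \<open>lev l\<close> be the index of the block that contains \<open>g\<^sub>l\<close>. The code is
  the set of all \<open>\<Sum>\<^sub>l c\<^sub>l g\<^sub>l\<close> with Laurent series \<open>c\<^sub>l\<close> divisible by \<open>p ^ lev l\<close>.

  The bound is the Singleton bound for the part of the code that is killed by \<open>p\<close>. Since \<open>G(0)\<close> has
  full row rank over \<open>R\<close>, some \<open>K\<close> of its columns already form an invertible matrix (an information
  set, \<open>information_set\<close>). The corresponding square submatrix \<open>M\<close> of \<open>G\<close> is then invertible over the
  power series ring, and if \<open>a\<close> is the first row of its inverse, \<open>v = p ^ (r - 1) a G\<close> is a codeword: the factor
  \<open>p ^ (r - 1)\<close> is divisible by every \<open>p ^ lev l\<close>. In the information columns \<open>v\<close> has the single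
  nonzero entry \<open>p ^ (r - 1)\<close>, of degree 0; so its truncation to the degrees \<open>0, \<dots>, j\<close> has weight at most
  \<open>(n - K) (j + 1) + 1\<close> (\<open>light_codeword\<close>).

  Two facts relate this to the statement. The column distance is read off a delay-free
  \<open>p\<close>-encoder, so one has to exist: the rows \<open>p ^ s g\<^sub>l\<close> with \<open>lev l \<le> s < r\<close> form one, because
  multiples of \<open>p ^ lev l\<close> have unique expansions in powers \<open>p ^ s\<close> with \<open>lev l \<le> s < r\<close> and digit coefficients,
  and because \<open>G(0)\<close> having full row rank forces the support of the \<open>c\<^sub>l\<close> to start no earlier
  than that of \<open>\<Sum>\<^sub>l c\<^sub>l g\<^sub>l\<close> (\<open>p_encoder_encoder\<close>, \<open>delay_free_encoder\<close>). And \<open>K\<close> must be at least \<open>k / r\<close>,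
  whichever \<open>p\<close>-encoder with \<open>k\<close> rows is given. This is a count: the \<open>p\<close>-linear combinations of its
  rows with coefficients of degree less than \<open>d\<close> are \<open>p ^ (k d)\<close> distinct polynomial codewords
  of degree less than \<open>d + \<delta>\<close> for some constant \<open>\<delta>\<close>, and such a codeword is determined by the first \<open>d + \<delta>\<close> coefficients of
  its \<open>K\<close> series \<open>c\<^sub>l\<close>. Hence \<open>k d \<le> r K (d + \<delta>)\<close> for all \<open>d\<close>, and so \<open>k \<le> r K\<close> (\<open>p_dimension_le\<close>).
\<close>

section \<open>Row vectors times matrices\<close>

lemma coeff_of_nat_mult: "poly.coeff (of_nat m * f) i = of_nat m * poly.coeff f i"
  by (induction m) (auto simp: algebra_simps)

lemma index_vec_mat_mult:
  assumes "u \<in> carrier_vec (dim_row A)" "c < dim_col A"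
  shows "vec_index (u \<^sub>v* A) c = (\<Sum>l<dim_row A. vec_index u l * index_mat A (l, c))"
  using assms
  by (auto simp: vec_mat_mult_def scalar_prod_def lessThan_atLeast0 mult.commute intro!: sum.cong)

lemma dim_vec_mat_mult [simp]: "dim_vec (u \<^sub>v* A) = dim_col A"
  by (simp add: vec_mat_mult_def)

lemma zero_in_digits: "p > 0 \<Longrightarrow> 0 \<in> digits p"
  by (force simp: digits_def)

lemma one_in_digits: "p > 1 \<Longrightarrow> 1 \<in> digits p"
  by (force simp: digits_def intro!: image_eqI[of _ _ 1])

lemma vecs_over_iff: "u \<in> vecs_over S m \<longleftrightarrow> u \<in> carrier_vec m \<and> (\<forall>l<m. vec_index u l \<in> S)"
  by (auto simp: vecs_over_def vec_set_def)

lemma index_smult_add_vec_mat_mult: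
  fixes A :: "'a :: comm_ring_1 mat"
  assumes "u \<in> carrier_vec (dim_row A)" "w \<in> carrier_vec (dim_row A)" "c < dim_col A"
  shows "vec_index ((a \<cdot>\<^sub>v u + w) \<^sub>v* A) c = a * vec_index (u \<^sub>v* A) c + vec_index (w \<^sub>v* A) c"
  using assms by (simp add: index_vec_mat_mult sum_distrib_left sum.distrib distrib_right mult.assoc)

lemma index_smult_vec_mat_mult:
  fixes A :: "'a :: comm_ring_1 mat"
  assumes "u \<in> carrier_vec (dim_row A)" "c < dim_col A"
  shows "vec_index ((a \<cdot>\<^sub>v u) \<^sub>v* A) c = a * vec_index (u \<^sub>v* A) c"
  using assms by (simp add: index_vec_mat_mult sum_distrib_left mult.assoc)

lemma bij_betw_vecs_over: "bij_betw (vec m) ({..<m} \<rightarrow>\<^sub>E S) (vecs_over S m)"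
proof (rule bij_betwI)
  show "vec m \<in> ({..<m} \<rightarrow>\<^sub>E S) \<rightarrow> vecs_over S m"
    by (intro funcsetI) (auto simp: vecs_over_iff dest: PiE_mem)
  show "(\<lambda>v. restrict (vec_index v) {..<m}) \<in> vecs_over S m \<rightarrow> ({..<m} \<rightarrow>\<^sub>E S)"
    by (intro funcsetI) (simp add: vecs_over_iff restrict_PiE_iff del: restrict_apply)
next
  fix f assume f: "f \<in> {..<m} \<rightarrow>\<^sub>E S"
  have "restrict (vec_index (vec m f)) {..<m} = restrict f {..<m}"
    by (rule restrict_ext) simp
  then show "restrict (vec_index (vec m f)) {..<m} = f"
    using PiE_restrict[OF f] by (rule trans)
next
  fix v assume "v \<in> vecs_over S m"
  then have "v \<in> carrier_vec m" by (simp add: vecs_over_iff)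
  then show "vec m (restrict (vec_index v) {..<m}) = v"
    by (intro eq_vecI) simp_all
qed

lemma card_vecs_over: "card (vecs_over S m) = card S ^ m"
  using bij_betw_same_card[OF bij_betw_vecs_over[of m S]] by (simp add: card_PiE)

lemma finite_vecs_over: "finite S \<Longrightarrow> finite (vecs_over S m)"
  using bij_betw_finite[OF bij_betw_vecs_over[of m S]] finite_PiE[of "{..<m}" "\<lambda>_. S"] by simp

section \<open>The ring of integers modulo a prime power\<close>

lemma digit_expansion_nat: "(\<Sum>s<r. (m div p ^ s mod p) * p ^ s) = m mod (p ^ r :: nat)"
proof (induction r)
  case (Suc r)
  then show ?case
    using mod_mult2_eq[of m "p ^ r" p] by (simp add: mult.commute)
qed simp

text \<open>
  The type argument only names the index type of the ring, so that the facts below can be stated for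
  \<open>'q mod_ring\<close> without mentioning an element.
\<close>

locale prime_power_ring =
  fixes p r :: nat and ty :: "'q :: nontriv itself"
  assumes prime: "prime p" and card: "CARD('q) = p ^ r"
begin

lemma p_gt_1: "p > 1"
  using prime by (rule prime_gt_1_nat)

lemma r_pos: "r > 0"
  using card nontriv[where ?'a = 'q] by (cases r) auto

definition nat_rep :: "'q mod_ring \<Rightarrow> nat" where
  "nat_rep x = nat (to_int_mod_ring x)"

lemma of_nat_nat_rep [simp]: "of_nat (nat_rep x) = x"
proof -
  have "to_int_mod_ring x \<ge> 0" using range_to_int_mod_ring[where ?'a = 'q] by auto
  then show ?thesis
    by (simp add: nat_rep_def of_nat_of_int_mod_ring)
qed

lemma nat_rep_less: "nat_rep x < p ^ r"
proof -
  have "to_int_mod_ring x \<in> {0..<int CARD('q)}" using range_to_int_mod_ring[where ?'a = 'q] by auto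
  then show ?thesis
    unfolding nat_rep_def using card by (simp add: nat_less_iff)
qed

lemma of_nat_eq_0_iff: "of_nat m = (0 :: 'q mod_ring) \<longleftrightarrow> p ^ r dvd m"
proof -
  have "of_nat m = (0 :: 'q mod_ring) \<longleftrightarrow> int m mod int CARD('q) = 0"
    unfolding of_nat_of_int_mod_ring
    by transfer simp
  also have "\<dots> \<longleftrightarrow> p ^ r dvd m"
    unfolding card by (metis dvd_eq_mod_eq_0 int_dvd_int_iff)
  finally show ?thesis .
qed

lemma nat_rep_0 [simp]: "nat_rep 0 = 0"
  using of_nat_eq_0_iff[of "nat_rep 0"] nat_rep_less[of 0] by (auto dest: dvd_imp_le)

lemma p_power_eq_0_iff: "of_nat p ^ s = (0 :: 'q mod_ring) \<longleftrightarrow> r \<le> s"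
  using of_nat_eq_0_iff[of "p ^ s"] p_gt_1 by (simp add: dvd_power_iff_le)

lemma p_power_r [simp]: "of_nat p ^ r = (0 :: 'q mod_ring)"
  by (simp add: p_power_eq_0_iff)

text \<open>
  The annihilator of \<open>p ^ i\<close> is generated by \<open>p ^ (r - i)\<close>.
\<close>

lemma p_power_annihilates:
  assumes "of_nat p ^ i * x = (0 :: 'q mod_ring)" "i \<le> r"
  obtains y where "x = of_nat p ^ (r - i) * y"
proof -
  have "of_nat (p ^ i * nat_rep x) = (0 :: 'q mod_ring)" using assms by simp
  then have "p ^ r dvd p ^ i * nat_rep x" by (simp only: of_nat_eq_0_iff)
  then have "p ^ i * p ^ (r - i) dvd p ^ i * nat_rep x"
    using assms(2) by (simp flip: power_add)
  then have "p ^ (r - i) dvd nat_rep x" using p_gt_1 by simp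
  then obtain m where "nat_rep x = p ^ (r - i) * m" by (elim dvdE)
  then have "x = of_nat (p ^ (r - i) * m)" by (metis of_nat_nat_rep)
  then have "x = of_nat p ^ (r - i) * of_nat m" by simp
  then show ?thesis by (rule that)
qed

text \<open>
  The digits are representatives of the residue field: no two of them are congruent modulo \<open>p\<close>.
\<close>

lemma digit_multiple_of_p:
  assumes "a \<in> digits p" "b \<in> digits p" "a - b = of_nat p * (y :: 'q mod_ring)"
  shows "a = b"
proof -
  obtain m m' where a: "a = of_nat m" "m < p" and b: "b = of_nat m'" "m' < p"
    using assms by (auto simp: digits_def)
  have main: "m = m'" if "m' \<le> m" "m < p" "of_nat m - of_nat m' = of_nat p * (y :: 'q mod_ring)" for m m' y
  proof -
    have "of_nat p ^ (r - 1) * (of_nat (m - m') :: 'q mod_ring) = of_nat p ^ (r - 1) * (of_nat p * y)"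
      using that by (simp add: of_nat_diff)
    also have "\<dots> = of_nat p ^ r * y"
      using r_pos by (cases r) (simp_all add: mult.assoc)
    finally have "of_nat (p ^ (r - 1) * (m - m')) = (0 :: 'q mod_ring)" by simp
    then have "p ^ r dvd p ^ (r - 1) * (m - m')" by (simp only: of_nat_eq_0_iff)
    then have "p ^ (r - 1) * p dvd p ^ (r - 1) * (m - m')"
      using r_pos by (cases r) (simp_all add: mult.commute)
    then have "p dvd m - m'" using p_gt_1 by simp
    then show "m = m'" using that by (auto dest: dvd_imp_le)
  qed
  show ?thesis
  proof (cases "m' \<le> m")
    case True
    then show ?thesis using main[of m' m y] a b assms by simp
  next
    case False
    have "b - a = of_nat p * (- y)" using assms(3) by (simp add: algebra_simps)
    then show ?thesis using main[of m m' "- y"] a b False by simp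
  qed
qed

text \<open>
  The ring is local with maximal ideal generated by \<open>p\<close>; a Bezout identity for the least residue and
  \<open>p ^ r\<close> exhibits the inverse.
\<close>

lemma unit_if_not_multiple_of_p:
  assumes "\<nexists>y. x = of_nat p * (y :: 'q mod_ring)"
  obtains c where "c * x = 1"
proof -
  have "\<not> p dvd nat_rep x"
  proof
    assume "p dvd nat_rep x"
    then obtain m where "nat_rep x = p * m" by (elim dvdE)
    then have "x = of_nat p * of_nat m" by (metis of_nat_nat_rep of_nat_mult)
    then show False using assms by blast
  qed
  then have "coprime (nat_rep x) (p ^ r)"
    using prime by (simp add: prime_imp_coprime coprime_commute)
  moreover have "nat_rep x \<noteq> 0" using \<open>\<not> p dvd nat_rep x\<close> by (metis dvd_0_right)
  ultimately obtain m t where "nat_rep x * m = p ^ r * t + 1"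
    by (metis bezout_nat coprime_imp_gcd_eq_1)
  then have "of_nat (nat_rep x * m) = (of_nat (p ^ r * t + 1) :: 'q mod_ring)" by (simp only:)
  then have "of_nat m * x = 1" by (simp add: mult.commute)
  then show ?thesis by (rule that)
qed

definition digit :: "nat \<Rightarrow> 'q mod_ring \<Rightarrow> 'q mod_ring" where
  "digit s x = of_nat (nat_rep x div p ^ s mod p)"

lemma digit_in_digits: "digit s x \<in> digits p"
  using p_gt_1 by (auto simp: digit_def digits_def)

lemma digit_0 [simp]: "digit s 0 = 0"
  by (simp add: digit_def)

lemma digit_expansion: "x = (\<Sum>s<r. of_nat p ^ s * digit s x)"
proof -
  have "x = of_nat (nat_rep x mod p ^ r)"
    using nat_rep_less[of x] by simp
  also have "\<dots> = (\<Sum>s<r. of_nat p ^ s * digit s x)"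
    by (simp add: digit_def flip: digit_expansion_nat) (simp add: mult.commute)
  finally show ?thesis .
qed

text \<open>
  After division by \<open>p ^ i\<close> the sum is \<open>d i\<close> plus a multiple of \<open>p\<close>, and it is annihilated by
  \<open>p ^ i\<close> with \<open>i < r\<close>, hence itself a multiple of \<open>p\<close>. So the lowest digit vanishes, and one continues with
  the next one.
\<close>

lemma digits_unique:
  assumes "\<And>s. i \<le> s \<Longrightarrow> s < r \<Longrightarrow> d s \<in> digits p"
    and "(\<Sum>s = i..<r. of_nat p ^ s * d s) = (0 :: 'q mod_ring)"
    and "i \<le> s" "s < r"
  shows "d s = 0"
  using assms
proof (induction "r - i" arbitrary: i)
  case (Suc m)
  then have i: "i < r" by simp
  have "(\<Sum>s = i..<r. of_nat p ^ s * d s) = of_nat p ^ i * d i + (\<Sum>s = Suc i..<r. of_nat p ^ s * d s)"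
    using i by (simp add: sum.atLeast_Suc_lessThan)
  also have "(\<Sum>s = Suc i..<r. of_nat p ^ s * d s) =
      of_nat p ^ i * (of_nat p * (\<Sum>s = Suc i..<r. of_nat p ^ (s - Suc i) * d s))"
    unfolding sum_distrib_left
  proof (intro sum.cong refl)
    fix s assume "s \<in> {Suc i..<r}"
    then have "s = i + Suc (s - Suc i)" by simp
    then have "of_nat p ^ s = (of_nat p ^ i * (of_nat p * of_nat p ^ (s - Suc i)) :: 'q mod_ring)"
      by (metis power_add power_Suc)
    then show "of_nat p ^ s * d s = of_nat p ^ i * (of_nat p * (of_nat p ^ (s - Suc i) * d s))"
      by (simp add: mult.assoc)
  qed
  finally have "of_nat p ^ i * (d i + of_nat p * (\<Sum>s = Suc i..<r. of_nat p ^ (s - Suc i) * d s)) = 0"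
    using Suc.prems(2) by (simp add: algebra_simps)
  then obtain y where y: "d i + of_nat p * (\<Sum>s = Suc i..<r. of_nat p ^ (s - Suc i) * d s) = of_nat p ^ (r - i) * y"
    using p_power_annihilates i by (metis less_imp_le)
  have "of_nat p ^ (r - i) * y = of_nat p * (of_nat p ^ (r - Suc i) * y)"
    using i by (simp flip: power_Suc mult.assoc add: Suc_diff_Suc)
  with y have "d i - 0 = of_nat p * (of_nat p ^ (r - Suc i) * y - (\<Sum>s = Suc i..<r. of_nat p ^ (s - Suc i) * d s))"
    by (simp add: algebra_simps)
  then have di: "d i = 0"
    using Suc.prems(1)[of i] i p_gt_1 zero_in_digits[of p]
    by (intro digit_multiple_of_p[of "d i" 0]) simp_all
  show ?case
  proof (cases "s = i")
    case False
    have "(\<Sum>s = Suc i..<r. of_nat p ^ s * d s) = 0"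
      using Suc.prems(2) di i by (simp add: sum.atLeast_Suc_lessThan)
    then show ?thesis
      using Suc.hyps(1)[of "Suc i"] Suc.hyps(2) Suc.prems False by simp
  qed (use di in simp)
qed simp

lemma digit_multiple_of_p_power:
  assumes "s < i" "i \<le> r"
  shows "digit s (of_nat p ^ i * x) = 0"
proof -
  have "of_nat (p ^ (r - i) * nat_rep (of_nat p ^ i * x)) = of_nat p ^ (r - i) * (of_nat p ^ i * x)"
    by simp
  also have "\<dots> = of_nat p ^ r * x"
    using assms(2) by (simp flip: mult.assoc power_add)
  finally have "of_nat (p ^ (r - i) * nat_rep (of_nat p ^ i * x)) = (0 :: 'q mod_ring)" by simp
  then have "p ^ r dvd p ^ (r - i) * nat_rep (of_nat p ^ i * x)" by (simp only: of_nat_eq_0_iff)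
  then have "p ^ (r - i) * p ^ i dvd p ^ (r - i) * nat_rep (of_nat p ^ i * x)"
    using assms(2) by (simp flip: power_add)
  then have "p ^ i dvd nat_rep (of_nat p ^ i * x)" using p_gt_1 by simp
  then have "p ^ s * p dvd nat_rep (of_nat p ^ i * x)"
    using assms(1) by (metis Suc_leI dvd_trans le_imp_power_dvd power_Suc2)
  then have "p dvd nat_rep (of_nat p ^ i * x) div p ^ s"
    using p_gt_1 by (elim dvdE) (simp add: mult.assoc)
  then show ?thesis by (simp add: digit_def)
qed

text \<open>
  Expansions of multiples of \<open>p ^ i\<close> start at \<open>p ^ i\<close>. This is what turns coefficients restricted to a
  block \<open>p ^ i B i\<close> into digit coefficients on the rows \<open>p ^ s g\<close> with \<open>s \<ge> i\<close>.
\<close>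

lemma digit_expansion_from:
  assumes "i \<le> r"
  shows "of_nat p ^ i * x = (\<Sum>s = i..<r. of_nat p ^ s * digit s (of_nat p ^ i * x))"
proof -
  have "of_nat p ^ i * x = (\<Sum>s<r. of_nat p ^ s * digit s (of_nat p ^ i * x))"
    by (rule digit_expansion)
  also have "\<dots> = (\<Sum>s = i..<r. of_nat p ^ s * digit s (of_nat p ^ i * x))"
    using assms digit_multiple_of_p_power by (intro sum.mono_neutral_right) auto
  finally show ?thesis .
qed

lemma digit_plus_multiple: "x = digit 0 x + of_nat p * of_nat (nat_rep x div p)"
proof -
  have "x = of_nat (nat_rep x mod p + p * (nat_rep x div p))" by (simp del: of_nat_add of_nat_mult)
  then show ?thesis unfolding of_nat_add of_nat_mult by (simp add: digit_def)
qed

end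

section \<open>Laurent series and supports\<close>

lemma fls_mult_of_nat_power_nth:
  "fls_nth (of_nat p ^ s * f) i = of_nat p ^ s * fls_nth (f :: 'a :: comm_ring_1 fls) i"
  by (metis fls_mult_of_nat_nth(1) of_nat_power)

lemma fps_to_fls_sum: "fps_to_fls (\<Sum>x\<in>A. f x) = (\<Sum>x\<in>A. fps_to_fls (f x))"
  by (induction A rule: infinite_finite_induct) simp_all

lemma fls_of_poly_mult: "fls_of_poly (f * g) = fls_of_poly f * fls_of_poly (g :: 'a :: comm_ring_1 poly)"
  by (simp add: fps_of_poly_mult fls_times_fps_to_fls)

lemma fls_of_poly_sum: "fls_of_poly (\<Sum>x\<in>A. f x) = (\<Sum>x\<in>A. fls_of_poly (f x :: 'a :: comm_ring_1 poly))"
  by (simp only: fps_of_poly_sum fps_to_fls_sum)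

lemma fls_of_poly_of_nat: "fls_of_poly (of_nat m) = (of_nat m :: 'a :: comm_ring_1 fls)"
  by (induction m) (simp_all add: fps_of_poly_add)

lemma laurent_vec_mat_mult:
  fixes a :: "'a :: comm_ring_1 poly vec"
  assumes "a \<in> carrier_vec (dim_row G)"
  shows "map_vec fls_of_poly (a \<^sub>v* G) = map_vec fls_of_poly a \<^sub>v* laurent_mat G"
proof (rule eq_vecI)
  fix c assume "c < dim_vec (map_vec fls_of_poly a \<^sub>v* laurent_mat G)"
  then have c: "c < dim_col G" by simp
  then show "vec_index (map_vec fls_of_poly (a \<^sub>v* G)) c
      = vec_index (map_vec fls_of_poly a \<^sub>v* laurent_mat G) c"
    using assms
    by (simp add: index_vec_mat_mult fls_of_poly_sum fls_of_poly_mult)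
qed simp

text \<open>
  In the lowest degree only the constant coefficient of the polynomial contributes.
\<close>

lemma fls_mult_poly_lowest:
  fixes f :: "'a :: comm_ring_1 fls"
  assumes "\<forall>i' < i. fls_nth f i' = 0"
  shows "fls_nth (f * fls_of_poly g) i = fls_nth f i * poly g 0"
proof (cases g)
  case (pCons a q)
  have "fls_nth (fls_of_poly q * (fls_X * f)) i = 0"
    using assms by (intro fls_mult_fps_low[of "i + 1"]) (auto simp: fls_X_times_conv_shift)
  moreover have "f * fls_of_poly (pCons a q) = fls_const a * f + fls_of_poly q * (fls_X * f)"
    by (simp add: fps_of_poly_pCons fls_times_fps_to_fls algebra_simps)
  ultimately show ?thesis
    using pCons by (simp add: mult.commute)
qed

lemma coeff_vec_mult_lowest:
  fixes u :: "'a :: comm_ring_1 fls vec"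
  assumes u: "u \<in> carrier_vec (dim_row G)" and supp: "supp u \<subseteq> {i..}"
  shows "coeff_vec (u \<^sub>v* laurent_mat G) i = coeff_vec u i \<^sub>v* eval0_mat G"
proof (rule eq_vecI)
  fix c assume "c < dim_vec (coeff_vec u i \<^sub>v* eval0_mat G)"
  then have c: "c < dim_col G" by simp
  have cu: "coeff_vec u i \<in> carrier_vec (dim_row G)"
    using u by (simp add: coeff_vec_def)
  have "fls_nth (vec_index u l * fls_of_poly (index_mat G (l, c))) i
      = fls_nth (vec_index u l) i * poly (index_mat G (l, c)) 0" if "l < dim_row G" for l
    using supp u that by (intro fls_mult_poly_lowest) (auto simp: supp_subset_iff)
  then have "vec_index (coeff_vec (u \<^sub>v* laurent_mat G) i) c
      = (\<Sum>l<dim_row G. fls_nth (vec_index u l) i * poly (index_mat G (l, c)) 0)"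
    using c u by (simp add: coeff_vec_def index_vec_mat_mult fls_nth_sum)
  also have "\<dots> = vec_index (coeff_vec u i \<^sub>v* eval0_mat G) c"
    using c cu u by (simp add: index_vec_mat_mult) (simp add: coeff_vec_def)
  finally show "vec_index (coeff_vec (u \<^sub>v* laurent_mat G) i) c
      = vec_index (coeff_vec u i \<^sub>v* eval0_mat G) c" .
qed (simp add: coeff_vec_def)

lemma supp_bounded_below: "\<exists>M. supp v \<subseteq> {M..}"
proof -
  have "\<exists>M. \<forall>c < m. \<forall>i < M. fls_nth (f c) i = 0" for m and f :: "nat \<Rightarrow> 'a fls"
  proof (induction m)
    case (Suc m)
    then obtain M where "\<forall>c < m. \<forall>i < M. fls_nth (f c) i = 0" by blast
    then have "\<forall>c < Suc m. \<forall>i < min M (fls_subdegree (f m)). fls_nth (f c) i = 0"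
      by (auto simp: less_Suc_eq)
    then show ?case by blast
  qed simp
  then show ?thesis unfolding supp_subset_iff by blast
qed

lemma supp_atLeast_extend:
  assumes "supp v \<subseteq> {i..}" "coeff_vec v i = 0\<^sub>v (dim_vec v)"
  shows "supp v \<subseteq> {i + 1..}"
proof
  fix x assume "x \<in> supp v"
  then have "x \<ge> i" "x \<noteq> i" using assms by (auto simp: supp_def)
  then show "x \<in> {i + 1..}" by simp
qed

text \<open>
  If the coefficient vector started at a degree \<open>i\<close> below \<open>N\<close>, its lowest coefficient would be a
  nonzero vector that \<open>G(0)\<close> sends to the coefficient of degree \<open>i\<close> of the product, which is 0. The
  proof moves the lower bound of the support upwards one degree at a time until it reaches \<open>N\<close>.
\<close>

lemma supp_coefficients:
  fixes u :: "'a :: comm_ring_1 fls vec"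
  assumes rank: "full_row_rank (eval0_mat G)" and u: "u \<in> carrier_vec (dim_row G)"
    and supp: "supp (u \<^sub>v* laurent_mat G) \<subseteq> {N..}"
  shows "supp u \<subseteq> {N..}"
proof -
  obtain M where M: "supp u \<subseteq> {M..}" using supp_bounded_below by blast
  have "supp u \<subseteq> {min N (M + int m)..}" for m
  proof (induction m)
    case 0
    then show ?case using M by auto
  next
    case (Suc m)
    show ?case
    proof (cases "M + int m < N")
      case True
      then have le: "supp u \<subseteq> {M + int m..}" using Suc by simp
      have "coeff_vec u (M + int m) \<^sub>v* eval0_mat G = coeff_vec (u \<^sub>v* laurent_mat G) (M + int m)"
        using coeff_vec_mult_lowest[OF u le] by simp
      also have "\<dots> = 0\<^sub>v (dim_col G)"
        using supp True by (auto simp: supp_def)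
      finally have "coeff_vec u (M + int m) = 0\<^sub>v (dim_row G)"
        using rank u by (simp add: full_row_rank_def coeff_vec_def)
      then show ?thesis
        using supp_atLeast_extend[OF le] u True by (simp add: add.assoc add.commute[of 1])
    qed (use Suc in auto)
  qed
  from this[of "nat (N - M)"] show ?thesis by (auto simp: min_def split: if_splits)
qed

section \<open>Spans of p-generator sequences and uniqueness of p-linear combinations\<close>

lemma mem_p_span:
  fixes vs :: "'a :: comm_ring_1 poly vec list"
  assumes "p > 1" "v \<in> set vs" "set vs \<subseteq> carrier_vec n"
  shows "v \<in> p_span p n vs"
proof -
  obtain i where i: "i < length vs" "v = vs ! i" using assms(2) by (metis in_set_conv_nth)
  have "(unit_vec (length vs) i :: 'a poly vec) \<in> vecs_over (digit_polys p) (length vs)"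
    using assms(1) zero_in_digits[of p, where ?'a = 'a] one_in_digits[OF assms(1), where ?'a = 'a]
    by (auto simp: vecs_over_def digit_polys_def vec_set_def unit_vec_def)
  moreover have "v = unit_vec (length vs) i \<^sub>v* mat_of_rows n vs"
  proof (rule eq_vecI)
    fix c assume "c < dim_vec (unit_vec (length vs) i \<^sub>v* mat_of_rows n vs)"
    then show "vec_index v c = vec_index (unit_vec (length vs) i \<^sub>v* mat_of_rows n vs) c"
      using i by (simp add: index_vec_mat_mult mat_of_rows_index unit_vec_def if_distrib[of "\<lambda>x. x * _"]
          sum.delta cong: if_cong)
  next
    have "v \<in> carrier_vec n" using assms by blast
    then show "dim_vec v = dim_vec (unit_vec (length vs) i \<^sub>v* mat_of_rows n vs)" by simp
  qed
  ultimately show ?thesis unfolding p_span_def by blast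
qed

lemma zero_mem_p_span:
  assumes "p > 0"
  shows "0\<^sub>v n \<in> p_span p n (vs :: 'a :: comm_ring_1 poly vec list)"
proof -
  have "(0\<^sub>v (length vs) :: 'a poly vec) \<in> vecs_over (digit_polys p) (length vs)"
    using zero_in_digits[OF assms, where ?'a = 'a]
    by (auto simp: vecs_over_def digit_polys_def vec_set_def)
  moreover have "0\<^sub>v n = 0\<^sub>v (length vs) \<^sub>v* mat_of_rows n vs"
    by (rule eq_vecI) (simp_all add: index_vec_mat_mult)
  ultimately show ?thesis unfolding p_span_def by blast
qed

text \<open>
  A combination equal to 0 has its support in \<open>{N..}\<close> for every \<open>N\<close>, so delay-freeness empties the
  support of its coefficients.
\<close>

lemma p_lin_indep_if_delay_free:
  fixes G :: "'a :: comm_ring_1 poly mat"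
  assumes "p > 0" "delay_free p G"
  shows "p_lin_indep p (dim_col G) (rows G)"
  unfolding p_lin_indep_def
proof (intro ballI impI)
  fix a assume a: "a \<in> vecs_over (digit_polys p) (length (rows G))"
    and "a \<^sub>v* mat_of_rows (dim_col G) (rows G) = 0\<^sub>v (dim_col G)"
  then have zero: "a \<^sub>v* G = 0\<^sub>v (dim_col G)" by simp
  have dim: "a \<in> carrier_vec (dim_row G)" using a by (simp add: vecs_over_def)
  have dig: "poly.coeff (vec_index a l) i \<in> digits p" if "l < dim_row G" for l i
    using a that dim by (auto simp: vecs_over_def digit_polys_def vec_set_def)
  define u where "u = map_vec fls_of_poly a"
  have "fls_nth (fls_of_poly (vec_index a l)) i \<in> digits p" if "l < dim_row G" for l i
    using dig[OF that] zero_in_digits[OF assms(1), where ?'a = 'a] by simp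
  then have u: "u \<in> vecs_over (digit_laurent p) (dim_row G)"
    using dim by (auto simp: u_def vecs_over_def digit_laurent_def vec_set_def)
  have "u \<^sub>v* laurent_mat G = map_vec fls_of_poly (0\<^sub>v (dim_col G))"
    using laurent_vec_mat_mult[OF dim] zero by (simp add: u_def)
  then have "supp (u \<^sub>v* laurent_mat G) \<subseteq> {N..}" for N
    by (simp add: supp_subset_iff)
  then have "supp u \<subseteq> {N..}" for N
    using assms(2) u by (auto simp: delay_free_def)
  then have nth0: "fls_nth (vec_index u l) i = 0" if "l < dim_row G" for l i
    using that dim \<open>supp u \<subseteq> {i + 1..}\<close> unfolding supp_subset_iff u_def by simp
  have "vec_index a l = 0" if "l < dim_row G" for l
  proof (rule poly_eqI)
    fix i show "poly.coeff (vec_index a l) i = poly.coeff 0 i"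
      using nth0[OF that, of "int i"] that dim by (simp add: u_def)
  qed
  then show "a = 0\<^sub>v (length (rows G))"
    using dim by auto
qed

lemma p_span_index:
  assumes "v \<in> p_span p n vs" "set vs \<subseteq> carrier_vec n"
  obtains a where "\<And>i. i < length vs \<Longrightarrow> a i \<in> digit_polys p"
    and "\<And>c. c < n \<Longrightarrow> vec_index v c = (\<Sum>i<length vs. a i * vec_index (vs ! i) c)"
proof -
  obtain a where a: "a \<in> vecs_over (digit_polys p) (length vs)" "v = a \<^sub>v* mat_of_rows n vs"
    using assms(1) by (auto simp: p_span_def)
  show ?thesis
  proof
    show "vec_index a i \<in> digit_polys p" if "i < length vs" for i
      using a that by (auto simp: vecs_over_def vec_set_def)
    show "vec_index v c = (\<Sum>i<length vs. vec_index a i * vec_index (vs ! i) c)" if "c < n" for c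
      using a that by (simp add: vecs_over_def index_vec_mat_mult mat_of_rows_index)
  qed
qed

lemma p_lin_indep_index:
  assumes "p_lin_indep p n vs" "\<And>i. i < length vs \<Longrightarrow> a i \<in> digit_polys p"
    and "\<And>c. c < n \<Longrightarrow> (\<Sum>i<length vs. a i * vec_index (vs ! i) c) = 0"
    and "i < length vs"
  shows "a i = 0"
proof -
  have "vec (length vs) a \<in> vecs_over (digit_polys p) (length vs)"
    using assms(2) by (auto simp: vecs_over_def vec_set_def)
  moreover have "vec (length vs) a \<^sub>v* mat_of_rows n vs = 0\<^sub>v n"
    using assms(3) by (intro eq_vecI) (simp_all add: index_vec_mat_mult mat_of_rows_index)
  ultimately have "vec (length vs) a = 0\<^sub>v (length vs)"
    using assms(1) by (auto simp: p_lin_indep_def)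
  then show ?thesis using assms(4) by (metis index_vec index_zero_vec(1))
qed

text \<open>
  The condition on the last vector is the condition \<open>p v \<in> p_span\<close> with the empty list of later
  vectors, so both conditions become one in an induction over the list.
\<close>

lemma p_generator_sequence_ConsD:
  assumes "p > 0" "p_generator_sequence p n (v # vs)"
  shows "p_generator_sequence p n vs" and "of_nat p \<cdot>\<^sub>v v \<in> p_span p n vs"
    and "v \<in> carrier_vec n" "set vs \<subseteq> carrier_vec n"
proof -
  have step: "of_nat p \<cdot>\<^sub>v (v # vs) ! i \<in> p_span p n (drop (Suc i) (v # vs))"
    if "Suc i < length (v # vs)" for i
    using assms(2) that by (simp add: p_generator_sequence_def)
  show sub: "v \<in> carrier_vec n" "set vs \<subseteq> carrier_vec n"
    using assms(2) by (auto simp: p_generator_sequence_def)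
  have "of_nat p \<cdot>\<^sub>v vs ! i \<in> p_span p n (drop (Suc i) vs)" if "Suc i < length vs" for i
    using step[of "Suc i"] that by simp
  moreover have "of_nat p \<cdot>\<^sub>v last vs = 0\<^sub>v n" if "vs \<noteq> []"
    using assms(2) that by (simp add: p_generator_sequence_def)
  ultimately show "p_generator_sequence p n vs"
    using sub unfolding p_generator_sequence_def by blast
  show "of_nat p \<cdot>\<^sub>v v \<in> p_span p n vs"
  proof (cases "vs = []")
    case True
    then have "of_nat p \<cdot>\<^sub>v v = 0\<^sub>v n" using assms(2) by (simp add: p_generator_sequence_def)
    then show ?thesis using zero_mem_p_span[OF assms(1)] by simp
  next
    case False
    then show ?thesis using step[of 0] by simp
  qed
qed

text \<open>
  A relation among the later vectors is a relation of the whole list with first coefficient 0.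
\<close>

lemma p_basis_ConsD:
  assumes "p > 0" "p_basis p n (v # vs)"
  shows "p_basis p n vs"
  unfolding p_basis_def
proof
  show "p_generator_sequence p n vs"
    using assms p_generator_sequence_ConsD by (auto simp: p_basis_def)
  show "p_lin_indep p n vs"
    unfolding p_lin_indep_def
  proof (intro ballI impI)
    fix a :: "'a poly vec"
    assume a: "a \<in> vecs_over (digit_polys p) (length vs)" and zero: "a \<^sub>v* mat_of_rows n vs = 0\<^sub>v n"
    have dim: "a \<in> carrier_vec (length vs)" using a by (simp add: vecs_over_def)
    define b where "b = case_nat 0 (vec_index a)"
    have b: "b i \<in> digit_polys p" if "i < length (v # vs)" for i
      using a that dim zero_in_digits[OF assms(1), where ?'a = 'a]
      by (cases i) (auto simp: b_def digit_polys_def vecs_over_def vec_set_def)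
    have "(\<Sum>i<length (v # vs). b i * vec_index ((v # vs) ! i) c) = 0" if "c < n" for c
    proof -
      have "(\<Sum>i<length (v # vs). b i * vec_index ((v # vs) ! i) c)
          = vec_index (a \<^sub>v* mat_of_rows n vs) c"
        using that dim by (simp add: b_def sum.lessThan_Suc_shift index_vec_mat_mult mat_of_rows_index
            del: sum.lessThan_Suc)
      then show ?thesis using zero that by simp
    qed
    moreover have "p_lin_indep p n (v # vs)" using assms(2) by (simp add: p_basis_def)
    ultimately have "b (Suc i) = 0" if "i < length vs" for i
      using that b p_lin_indep_index[of p n "v # vs" b "Suc i"] by simp
    then show "a = 0\<^sub>v (length vs)" using dim by (auto simp: b_def)
  qed
qed

context prime_power_ring
begin

lemma poly_digit_plus_multiple:
  obtains e y where "e \<in> digit_polys p" "(f :: 'q mod_ring poly) = e + of_nat p * y"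
proof
  show "map_poly (digit 0) f \<in> digit_polys p"
    using digit_in_digits by (auto simp: digit_polys_def coeff_map_poly)
  show "f = map_poly (digit 0) f + of_nat p * map_poly (\<lambda>x. of_nat (nat_rep x div p)) f"
    using digit_plus_multiple by (intro poly_eqI) (simp add: coeff_map_poly coeff_of_nat_mult)
qed

text \<open>
  The \<open>p\<close>-span of a \<open>p\<close>-generator sequence is a module. To normalise a combination, reduce the first
  coefficient to a digit polynomial modulo \<open>p\<close>; the carry \<open>y\<close> multiplies \<open>p v\<close>, which is a combination of
  the later vectors and is passed on to them. The last conjunct records that the first coefficient changes
  by a multiple of \<open>p\<close> only; it makes the uniqueness result below possible.
\<close>

lemma combination_eq_p_combination:
  fixes f :: "nat \<Rightarrow> 'q mod_ring poly"
  assumes "p_generator_sequence p n vs"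
  shows "\<exists>e. (\<forall>i<length vs. e i \<in> digit_polys p) \<and>
    (\<forall>c<n. (\<Sum>i<length vs. f i * vec_index (vs ! i) c) = (\<Sum>i<length vs. e i * vec_index (vs ! i) c)) \<and>
    (vs \<noteq> [] \<longrightarrow> (\<exists>y. f 0 = e 0 + of_nat p * y))"
  using assms
proof (induction vs arbitrary: f)
  case (Cons v vs)
  have p: "p > 0" using p_gt_1 by simp
  note gen = p_generator_sequence_ConsD[OF p Cons.prems]
  obtain a where a: "\<And>c. c < n \<Longrightarrow>
      vec_index (of_nat p \<cdot>\<^sub>v v) c = (\<Sum>i<length vs. a i * vec_index (vs ! i) c)"
    using p_span_index[OF gen(2,4)] by metis
  obtain e0 y where e0: "e0 \<in> digit_polys p" "f 0 = e0 + of_nat p * y"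
    using poly_digit_plus_multiple .
  obtain e where e: "\<forall>i<length vs. e i \<in> digit_polys p"
    "\<forall>c<n. (\<Sum>i<length vs. (f (Suc i) + y * a i) * vec_index (vs ! i) c)
        = (\<Sum>i<length vs. e i * vec_index (vs ! i) c)"
    using Cons.IH[OF gen(1), of "\<lambda>i. f (Suc i) + y * a i"] by blast
  show ?case
  proof (intro exI[of _ "case_nat e0 e"] conjI allI impI)
    fix i assume "i < length (v # vs)"
    then show "case_nat e0 e i \<in> digit_polys p" using e0 e by (cases i) auto
  next
    fix c assume c: "c < n"
    have "(\<Sum>i<length (v # vs). f i * vec_index ((v # vs) ! i) c)
        = f 0 * vec_index v c + (\<Sum>i<length vs. f (Suc i) * vec_index (vs ! i) c)"
      by (simp add: sum.lessThan_Suc_shift del: sum.lessThan_Suc)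
    also have "\<dots> = e0 * vec_index v c + y * vec_index (of_nat p \<cdot>\<^sub>v v) c
        + (\<Sum>i<length vs. f (Suc i) * vec_index (vs ! i) c)"
      using c gen(3) by (simp add: e0 algebra_simps)
    also have "\<dots> = e0 * vec_index v c + (\<Sum>i<length vs. (f (Suc i) + y * a i) * vec_index (vs ! i) c)"
      unfolding a[OF c] by (simp add: sum_distrib_left sum.distrib algebra_simps)
    also have "\<dots> = (\<Sum>i<length (v # vs). case_nat e0 e i * vec_index ((v # vs) ! i) c)"
      using c e(2) by (simp add: sum.lessThan_Suc_shift del: sum.lessThan_Suc)
    finally show "(\<Sum>i<length (v # vs). f i * vec_index ((v # vs) ! i) c)
      = (\<Sum>i<length (v # vs). case_nat e0 e i * vec_index ((v # vs) ! i) c)" .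
  qed (use e0 in auto)
qed simp

text \<open>
  The definition of \<open>p\<close>-linear independence only speaks about combinations equal to 0, while the
  difference of two digit polynomials need not be a digit polynomial. Normalising the difference of the
  two combinations gives a \<open>p\<close>-combination equal to 0; its first coefficient is 0, so the first
  coefficients of the two agree modulo \<open>p\<close> and hence are equal. The remaining ones follow by induction.
\<close>

lemma p_combination_unique:
  fixes f g :: "nat \<Rightarrow> 'q mod_ring poly"
  assumes "p_basis p n vs"
    and "\<And>i. i < length vs \<Longrightarrow> f i \<in> digit_polys p" "\<And>i. i < length vs \<Longrightarrow> g i \<in> digit_polys p"
    and "\<And>c. c < n \<Longrightarrow>
      (\<Sum>i<length vs. f i * vec_index (vs ! i) c) = (\<Sum>i<length vs. g i * vec_index (vs ! i) c)"
    and "i < length vs"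
  shows "f i = g i"
  using assms
proof (induction vs arbitrary: f g i)
  case (Cons v vs)
  have p: "p > 0" using p_gt_1 by simp
  obtain e y where e: "\<forall>i<length (v # vs). e i \<in> digit_polys p"
      "\<forall>c<n. (\<Sum>i<length (v # vs). (f i - g i) * vec_index ((v # vs) ! i) c)
        = (\<Sum>i<length (v # vs). e i * vec_index ((v # vs) ! i) c)"
      "f 0 - g 0 = e 0 + of_nat p * y"
    using combination_eq_p_combination[of n "v # vs" "\<lambda>i. f i - g i"] Cons.prems(1)
    unfolding p_basis_def by blast
  have "(\<Sum>i<length (v # vs). e i * vec_index ((v # vs) ! i) c) = 0" if "c < n" for c
  proof -
    have "(\<Sum>i<length (v # vs). (f i - g i) * vec_index ((v # vs) ! i) c) = 0"
      using Cons.prems(4)[OF that] by (simp only: left_diff_distrib sum_subtractf right_minus_eq)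
    then show ?thesis using e(2) that by simp
  qed
  moreover have "p_lin_indep p n (v # vs)" using Cons.prems(1) by (simp add: p_basis_def)
  ultimately have "e 0 = 0"
    using e(1) p_lin_indep_index[of p n "v # vs" e 0] by simp
  then have diff: "f 0 - g 0 = of_nat p * y" using e(3) by simp
  have "poly.coeff (f 0) m = poly.coeff (g 0) m" for m
  proof (rule digit_multiple_of_p)
    show "poly.coeff (f 0) m \<in> digits p" "poly.coeff (g 0) m \<in> digits p"
      using Cons.prems(2,3)[of 0] by (auto simp: digit_polys_def)
    show "poly.coeff (f 0) m - poly.coeff (g 0) m = of_nat p * poly.coeff y m"
      using diff by (metis coeff_diff coeff_of_nat_mult)
  qed
  then have 0: "f 0 = g 0" by (intro poly_eqI)
  show ?case
  proof (cases i)
    case (Suc i')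
    show ?thesis
      unfolding Suc
    proof (rule Cons.IH[of "\<lambda>i. f (Suc i)" "\<lambda>i. g (Suc i)"])
      show "p_basis p n vs" using p_basis_ConsD[OF p Cons.prems(1)] .
      show "(\<Sum>i<length vs. f (Suc i) * vec_index (vs ! i) c)
          = (\<Sum>i<length vs. g (Suc i) * vec_index (vs ! i) c)" if "c < n" for c
        using Cons.prems(4)[OF that] 0 by (simp add: sum.lessThan_Suc_shift del: sum.lessThan_Suc)
    qed (use Cons.prems Suc in auto)
  qed (simp add: 0)
qed simp

lemma of_nat_inj:
  assumes "of_nat m = (of_nat m' :: 'q mod_ring)" "m < p" "m' < p"
  shows "m = m'"
proof -
  have le: "p \<le> p ^ r" using r_pos p_gt_1 by (simp add: self_le_power)
  have *: "m = m'" if "of_nat m = (of_nat m' :: 'q mod_ring)" "m < p" "m' \<le> m" for m m'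
  proof -
    have "of_nat (m - m') = (0 :: 'q mod_ring)" using that by (simp add: of_nat_diff)
    then have "p ^ r dvd m - m'" by (simp only: of_nat_eq_0_iff)
    then show ?thesis using that le by (auto dest: dvd_imp_le)
  qed
  show ?thesis using *[of m m'] *[of m' m] assms by (cases "m' \<le> m") auto
qed

end

section \<open>A delay-free p-encoder\<close>

context prime_power_ring
begin

definition digit_fls :: "nat \<Rightarrow> 'q mod_ring fls \<Rightarrow> 'q mod_ring fls" where
  "digit_fls s f = Abs_fls (\<lambda>i. digit s (fls_nth f i))"

lemma digit_fls_nth [simp]: "fls_nth (digit_fls s f) i = digit s (fls_nth f i)"
  unfolding digit_fls_def by (rule nth_Abs_fls_lower_bound[of "fls_subdegree f"]) simp

lemma digit_fls_expansion_from:
  assumes "of_nat p ^ i dvd f" "i \<le> r"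
  shows "f = (\<Sum>s = i..<r. of_nat p ^ s * digit_fls s f)"
proof (rule fls_eqI)
  fix k
  obtain g where "f = of_nat p ^ i * g" using assms(1) by (elim dvdE)
  then have eq: "of_nat p ^ i * fls_nth g k = fls_nth f k" by (simp only: fls_mult_of_nat_power_nth)
  have "fls_nth f k = (\<Sum>s = i..<r. of_nat p ^ s * digit s (fls_nth f k))"
    using digit_expansion_from[OF assms(2), of "fls_nth g k"] unfolding eq .
  also have "\<dots> = fls_nth (\<Sum>s = i..<r. of_nat p ^ s * digit_fls s f) k"
    by (simp only: fls_nth_sum fls_mult_of_nat_power_nth digit_fls_nth)
  finally show "fls_nth f k = fls_nth (\<Sum>s = i..<r. of_nat p ^ s * digit_fls s f) k" .
qed

end

text \<open>
  A pair \<open>(l, s)\<close> stands for the row \<open>p ^ s g\<^sub>l\<close>. Sorting by the exponent puts \<open>p ^ (s + 1) g\<^sub>l\<close> after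
  \<open>p ^ s g\<^sub>l\<close>, as a \<open>p\<close>-generator sequence requires; any order among equal exponents will do, so the list may come
  from a choice.
\<close>

definition row_exponent_pairs :: "nat \<Rightarrow> nat \<Rightarrow> (nat \<Rightarrow> nat) \<Rightarrow> (nat \<times> nat) list" where
  "row_exponent_pairs r K lev =
     sort_key snd (SOME xs. distinct xs \<and> set xs = Sigma {..<K} (\<lambda>l. {lev l..<r}))"

lemma row_exponent_pairs:
  shows "distinct (row_exponent_pairs r K lev)"
    and "set (row_exponent_pairs r K lev) = Sigma {..<K} (\<lambda>l. {lev l..<r})"
    and "sorted (map snd (row_exponent_pairs r K lev))"
proof -
  have "finite (Sigma {..<K} (\<lambda>l. {lev l..<r}))" by auto
  then have "\<exists>xs. distinct xs \<and> set xs = Sigma {..<K} (\<lambda>l. {lev l..<r})"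
    by (metis finite_distinct_list)
  note * = someI_ex[OF this]
  show "distinct (row_exponent_pairs r K lev)"
    unfolding row_exponent_pairs_def distinct_sort by (rule conjunct1[OF *])
  show "set (row_exponent_pairs r K lev) = Sigma {..<K} (\<lambda>l. {lev l..<r})"
    unfolding row_exponent_pairs_def set_sort by (rule conjunct2[OF *])
  show "sorted (map snd (row_exponent_pairs r K lev))"
    unfolding row_exponent_pairs_def by (rule sorted_sort_key)
qed

text \<open>
  \<open>G\<close> is the stack of the blocks without their powers of \<open>p\<close>, and \<open>lev l\<close> is the exponent that
  belongs to row \<open>l\<close>.
\<close>

locale graded_generators = prime_power_ring p r ty
  for p r :: nat and ty :: "'q :: nontriv itself" +
  fixes G :: "'q mod_ring poly mat" and lev :: "nat \<Rightarrow> nat"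
  assumes rank0: "full_row_rank (eval0_mat G)" and lev: "\<And>l. l < dim_row G \<Longrightarrow> lev l < r"
begin

abbreviation K :: nat where "K \<equiv> dim_row G"
abbreviation n :: nat where "n \<equiv> dim_col G"

definition code :: "'q mod_ring fls vec set" where
  "code = {c \<^sub>v* laurent_mat G | c. c \<in> carrier_vec K \<and> (\<forall>l<K. of_nat p ^ lev l dvd vec_index c l)}"

definition row_exponents :: "(nat \<times> nat) list" where
  "row_exponents = row_exponent_pairs r K lev"

lemmas row_exponents = row_exponent_pairs[of r K lev, folded row_exponents_def]

definition power_rows :: "'q mod_ring poly vec list" where
  "power_rows = map (\<lambda>(l, s). of_nat (p ^ s) \<cdot>\<^sub>v row G l) row_exponents"

definition encoder :: "'q mod_ring poly mat" where
  "encoder = mat_of_rows n power_rows"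

definition pos :: "nat \<times> nat \<Rightarrow> nat" where
  "pos = the_inv_into {..<length row_exponents} (nth row_exponents)"

lemma bij_row_exponents: "bij_betw (nth row_exponents) {..<length row_exponents} (set row_exponents)"
  using row_exponents(1) refl refl by (rule bij_betw_nth)

lemma pos_nth [simp]: "t < length row_exponents \<Longrightarrow> pos (row_exponents ! t) = t"
  unfolding pos_def using bij_row_exponents by (intro the_inv_into_f_f) (auto simp: bij_betw_def)

lemma pos_mem:
  assumes "l < K" "lev l \<le> s" "s < r"
  shows "pos (l, s) < length row_exponents" "row_exponents ! pos (l, s) = (l, s)"
proof -
  have "(l, s) \<in> set row_exponents" using assms row_exponents(2) by auto
  then obtain t where "t < length row_exponents" "row_exponents ! t = (l, s)" by (metis in_set_conv_nth)
  then show "pos (l, s) < length row_exponents" "row_exponents ! pos (l, s) = (l, s)" using pos_nth[of t] by auto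
qed

lemma power_rows_carrier: "set power_rows \<subseteq> carrier_vec n"
proof
  fix v assume "v \<in> set power_rows"
  then obtain l s where "v = of_nat (p ^ s) \<cdot>\<^sub>v row G l" by (auto simp: power_rows_def)
  then show "v \<in> carrier_vec n" by (simp only: smult_carrier_vec row_carrier)
qed

lemma encoder_simps [simp]:
  "dim_row encoder = length row_exponents" "dim_col encoder = n" "rows encoder = power_rows"
  subgoal by (simp add: encoder_def power_rows_def)
  subgoal by (simp add: encoder_def)
  subgoal unfolding encoder_def by (rule rows_mat_of_rows[OF power_rows_carrier])
  done

lemma encoder_index:
  assumes "t < length row_exponents" "c < n"
  shows "index_mat (laurent_mat encoder) (t, c)
    = of_nat p ^ snd (row_exponents ! t) * fls_of_poly (index_mat G (fst (row_exponents ! t), c))"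
proof -
  have "row_exponents ! t \<in> set row_exponents" using assms by simp
  then have "fst (row_exponents ! t) < K" using row_exponents(2) by auto
  then have "index_mat encoder (t, c) = of_nat (p ^ snd (row_exponents ! t)) * index_mat G (fst (row_exponents ! t), c)"
    using assms by (simp add: encoder_def power_rows_def mat_of_rows_index case_prod_unfold)
  then have "index_mat (laurent_mat encoder) (t, c)
    = fls_of_poly (of_nat (p ^ snd (row_exponents ! t))) * fls_of_poly (index_mat G (fst (row_exponents ! t), c))"
    using assms by (simp only: index_map_mat encoder_simps fls_of_poly_mult)
  then show ?thesis unfolding fls_of_poly_of_nat unfolding of_nat_power .
qed

text \<open>
  The coefficients over the rows of \<open>G\<close> of a combination of the rows \<open>p ^ s g\<^sub>l\<close>, obtained by adding up the
  multiples of the same \<open>g\<^sub>l\<close>. On digit coefficients this inverts taking digit expansions.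
\<close>

definition merge :: "'q mod_ring fls vec \<Rightarrow> 'q mod_ring fls vec" where
  "merge u = vec K (\<lambda>l. \<Sum>s = lev l..<r. of_nat p ^ s * vec_index u (pos (l, s)))"

lemma mult_encoder:
  assumes u: "u \<in> carrier_vec (length row_exponents)"
  shows "u \<^sub>v* laurent_mat encoder = merge u \<^sub>v* laurent_mat G"
proof (rule eq_vecI)
  fix c assume "c < dim_vec (merge u \<^sub>v* laurent_mat G)"
  then have c: "c < n" by simp
  define g where "g l = fls_of_poly (index_mat G (l, c))" for l
  have "vec_index (u \<^sub>v* laurent_mat encoder) c
      = (\<Sum>t<length row_exponents. vec_index u (pos (row_exponents ! t)) * (of_nat p ^ snd (row_exponents ! t) * g (fst (row_exponents ! t))))"
    using c u encoder_index by (simp add: index_vec_mat_mult g_def del: index_map_mat(1))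
  also have "\<dots> = (\<Sum>x\<in>set row_exponents. vec_index u (pos x) * (of_nat p ^ snd x * g (fst x)))"
    by (rule sum.reindex_bij_betw[OF bij_row_exponents])
  also have "\<dots> = (\<Sum>l<K. \<Sum>s = lev l..<r. vec_index u (pos (l, s)) * (of_nat p ^ s * g l))"
    unfolding row_exponents(2) by (simp add: sum.Sigma case_prod_unfold)
  also have "\<dots> = vec_index (merge u \<^sub>v* laurent_mat G) c"
    using c by (simp add: index_vec_mat_mult merge_def g_def sum_distrib_left sum_distrib_right ac_simps)
  finally show "vec_index (u \<^sub>v* laurent_mat encoder) c = vec_index (merge u \<^sub>v* laurent_mat G) c" .
qed simp

lemma merge_surj:
  assumes c: "c \<in> carrier_vec K" "\<forall>l<K. of_nat p ^ lev l dvd vec_index c l"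
  obtains u where "u \<in> vecs_over (digit_laurent p) (length row_exponents)" "merge u = c"
proof
  define u where "u = vec (length row_exponents) (\<lambda>t. digit_fls (snd (row_exponents ! t)) (vec_index c (fst (row_exponents ! t))))"
  show "u \<in> vecs_over (digit_laurent p) (length row_exponents)"
    using digit_in_digits by (auto simp: u_def vecs_over_def digit_laurent_def vec_set_def)
  show "merge u = c"
  proof (rule eq_vecI)
    fix l assume "l < dim_vec c"
    then have l: "l < K" using c by simp
    have "vec_index (merge u) l = (\<Sum>s = lev l..<r. of_nat p ^ s * digit_fls s (vec_index c l))"
      using l pos_mem[OF l] by (simp add: merge_def u_def)
    also have "\<dots> = vec_index c l"
      using c(2) l lev[OF l] by (intro digit_fls_expansion_from[symmetric]) simp_all
    finally show "vec_index (merge u) l = vec_index c l" .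
  qed (use c in \<open>simp add: merge_def\<close>)
qed

lemma code_eq_encoder_image:
  "code = {u \<^sub>v* laurent_mat encoder | u. u \<in> vecs_over (digit_laurent p) (length row_exponents)}"
proof (intro equalityI subsetI)
  fix v assume "v \<in> code"
  then obtain c where "v = c \<^sub>v* laurent_mat G" "c \<in> carrier_vec K"
      "\<forall>l<K. of_nat p ^ lev l dvd vec_index c l"
    by (auto simp: code_def)
  then show "v \<in> {u \<^sub>v* laurent_mat encoder | u. u \<in> vecs_over (digit_laurent p) (length row_exponents)}"
    using merge_surj[of c] mult_encoder by (smt (verit) mem_Collect_eq vecs_over_def)
next
  fix v assume "v \<in> {u \<^sub>v* laurent_mat encoder | u. u \<in> vecs_over (digit_laurent p) (length row_exponents)}"
  then obtain u where u: "u \<in> carrier_vec (length row_exponents)" "v = u \<^sub>v* laurent_mat encoder"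
    by (auto simp: vecs_over_def)
  have "of_nat p ^ lev l dvd vec_index (merge u) l" if "l < K" for l
    using that by (auto simp: merge_def intro!: dvd_sum dvd_mult2 le_imp_power_dvd)
  moreover have "merge u \<in> carrier_vec K" by (simp add: merge_def)
  ultimately show "v \<in> code" using u mult_encoder unfolding code_def by blast
qed

text \<open>
  The merged coefficients inherit the bound on the support from the codeword, and by uniqueness of
  digits they vanish in a degree only if all their digits do.
\<close>

lemma delay_free_encoder: "delay_free p encoder"
  unfolding delay_free_def
proof (intro ballI allI impI)
  fix u N
  assume u: "u \<in> vecs_over (digit_laurent p) (dim_row encoder)"
    and supp: "supp (u \<^sub>v* laurent_mat encoder) \<subseteq> {N..}"
  have dim: "u \<in> carrier_vec (length row_exponents)" using u by (simp add: vecs_over_def)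
  have "supp (merge u) \<subseteq> {N..}"
    using supp_coefficients[OF rank0, of "merge u" N] supp mult_encoder[OF dim] by (simp add: merge_def)
  then have zero: "(\<Sum>s = lev l..<r. of_nat p ^ s * fls_nth (vec_index u (pos (l, s))) i) = 0"
    if "l < K" "i < N" for l i
    using that by (simp add: supp_subset_iff merge_def fls_nth_sum fls_mult_of_nat_power_nth)
  have dig: "fls_nth (vec_index u t) i \<in> digits p" if "t < length row_exponents" for t i
    using u that dim by (auto simp: vecs_over_def digit_laurent_def vec_set_def)
  have "fls_nth (vec_index u t) i = 0" if t: "t < length row_exponents" and i: "i < N" for t i
  proof -
    obtain l s where ls: "row_exponents ! t = (l, s)" by force
    then have "(l, s) \<in> set row_exponents" using t by (metis nth_mem)
    then have mem: "l < K" "lev l \<le> s" "s < r" using row_exponents(2) by auto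
    have "fls_nth (vec_index u (pos (l, s))) i = 0"
    proof (rule digits_unique[where i = "lev l" and d = "\<lambda>s. fls_nth (vec_index u (pos (l, s))) i"])
      show "fls_nth (vec_index u (pos (l, s))) i \<in> digits p" if "lev l \<le> s" "s < r" for s
        using that pos_mem[OF mem(1)] dig by blast
      show "(\<Sum>s = lev l..<r. of_nat p ^ s * fls_nth (vec_index u (pos (l, s))) i) = 0"
        using zero mem(1) i by blast
    qed (use mem in auto)
    then show ?thesis using ls t pos_nth by metis
  qed
  then show "supp u \<subseteq> {N..}" using dim by (simp add: supp_subset_iff)
qed

lemma p_generator_sequence_power_rows: "p_generator_sequence p n power_rows"
proof -
  have step: "of_nat p \<cdot>\<^sub>v power_rows ! i = 0\<^sub>v n \<or>
      of_nat p \<cdot>\<^sub>v power_rows ! i \<in> set (drop (Suc i) power_rows)"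
    if i: "i < length row_exponents" for i
  proof -
    obtain l s where ls: "row_exponents ! i = (l, s)" by force
    then have "(l, s) \<in> set row_exponents" using i by (metis nth_mem)
    then have mem: "l < K" "lev l \<le> s" "s < r" using row_exponents(2) by auto
    have eq: "of_nat p \<cdot>\<^sub>v power_rows ! i = of_nat (p ^ Suc s) \<cdot>\<^sub>v row G l"
      using i ls by (simp add: power_rows_def smult_smult_assoc)
    show ?thesis
    proof (cases "Suc s < r")
      case True
      define j where "j = pos (l, Suc s)"
      have j: "j < length row_exponents" "row_exponents ! j = (l, Suc s)"
        using pos_mem[of l "Suc s"] mem True by (auto simp: j_def)
      have "i < j"
      proof (rule ccontr)
        assume "\<not> i < j"
        then have "snd (row_exponents ! j) \<le> snd (row_exponents ! i)"
          using sorted_nth_mono[OF row_exponents(3), of j i] i j by simp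
        then show False using ls j by simp
      qed
      then have "power_rows ! j = drop (Suc i) power_rows ! (j - Suc i)"
          "j - Suc i < length (drop (Suc i) power_rows)"
        using j by (simp_all add: power_rows_def)
      then have "power_rows ! j \<in> set (drop (Suc i) power_rows)"
        by (metis nth_mem)
      then show ?thesis using eq j by (simp add: power_rows_def)
    next
      case False
      then have "Suc s = r" using mem by simp
      then have "of_nat (p ^ Suc s) = (0 :: 'q mod_ring)" by (simp del: power_Suc)
      then have "of_nat (p ^ Suc s) = (0 :: 'q mod_ring poly)"
        by (metis of_nat_poly pCons_0_0)
      then have "of_nat p \<cdot>\<^sub>v power_rows ! i = 0\<^sub>v n"
        unfolding eq by (intro eq_vecI) (simp_all del: power_Suc of_nat_power)
      then show ?thesis ..
    qed
  qed
  have len: "length power_rows = length row_exponents" by (simp add: power_rows_def)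
  show ?thesis
    unfolding p_generator_sequence_def
  proof (intro conjI allI impI)
    fix i assume "Suc i < length power_rows"
    then have "i < length row_exponents" using len by simp
    moreover have "set (drop (Suc i) power_rows) \<subseteq> carrier_vec n"
      using power_rows_carrier by (meson order_trans set_drop_subset)
    ultimately show "of_nat p \<cdot>\<^sub>v power_rows ! i \<in> p_span p n (drop (Suc i) power_rows)"
      using step[of i] mem_p_span[OF p_gt_1] zero_mem_p_span[of p] p_gt_1 by force
  next
    assume "power_rows \<noteq> []"
    then have "last power_rows = power_rows ! (length row_exponents - 1)" "row_exponents \<noteq> []"
      using len by (auto simp: last_conv_nth)
    then show "of_nat p \<cdot>\<^sub>v last power_rows = 0\<^sub>v n"
      using step[of "length row_exponents - 1"] len by (cases row_exponents) auto
  qed (rule power_rows_carrier)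
qed

lemma p_encoder_encoder: "p_encoder p n code encoder"
  using p_generator_sequence_power_rows p_lin_indep_if_delay_free[OF _ delay_free_encoder] p_gt_1
  by (simp add: p_encoder_def p_basis_def code_eq_encoder_image)

end

context graded_generators
begin

text \<open>
  Connects the locale with a generator matrix whose rows carry the powers of \<open>p\<close> explicitly.
\<close>

lemma code_eq_scaled_image:
  assumes dims: "dim_row H = K" "dim_col H = n"
    and H: "\<And>l c. l < K \<Longrightarrow> c < n \<Longrightarrow> index_mat H (l, c) = of_nat (p ^ lev l) * index_mat G (l, c)"
  shows "{u \<^sub>v* laurent_mat H | u. u \<in> carrier_vec (dim_row H)} = code"
proof -
  have mult: "u \<^sub>v* laurent_mat H = vec K (\<lambda>l. of_nat p ^ lev l * vec_index u l) \<^sub>v* laurent_mat G"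
    if u: "u \<in> carrier_vec K" for u
  proof (rule eq_vecI)
    fix c assume "c < dim_vec (vec K (\<lambda>l. of_nat p ^ lev l * vec_index u l) \<^sub>v* laurent_mat G)"
    then have c: "c < n" by simp
    have "fls_of_poly (index_mat H (l, c)) = of_nat p ^ lev l * fls_of_poly (index_mat G (l, c))"
      if "l < K" for l
      unfolding H[OF that c] fls_of_poly_mult fls_of_poly_of_nat unfolding of_nat_power ..
    then show "vec_index (u \<^sub>v* laurent_mat H) c
        = vec_index (vec K (\<lambda>l. of_nat p ^ lev l * vec_index u l) \<^sub>v* laurent_mat G) c"
      using u c dims by (simp add: index_vec_mat_mult ac_simps)
  qed (simp add: dims)
  show ?thesis
  proof (intro equalityI subsetI)
    fix v assume "v \<in> {u \<^sub>v* laurent_mat H | u. u \<in> carrier_vec (dim_row H)}"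
    then obtain u where u: "u \<in> carrier_vec K" "v = u \<^sub>v* laurent_mat H" using dims by auto
    let ?c = "vec K (\<lambda>l. of_nat p ^ lev l * vec_index u l)"
    have "?c \<in> carrier_vec K" "\<forall>l<K. of_nat p ^ lev l dvd vec_index ?c l" by simp_all
    then show "v \<in> code" unfolding code_def u(2) mult[OF u(1)] by blast
  next
    fix v assume "v \<in> code"
    then obtain c where c: "v = c \<^sub>v* laurent_mat G" "c \<in> carrier_vec K"
      "\<forall>l<K. of_nat p ^ lev l dvd vec_index c l"
      by (auto simp: code_def)
    then have "\<forall>l. \<exists>y. l < K \<longrightarrow> vec_index c l = of_nat p ^ lev l * y" by (auto simp: dvd_def)
    from choice[OF this] obtain y where y: "\<forall>l<K. vec_index c l = of_nat p ^ lev l * y l" by blast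
    have "vec K (\<lambda>l. of_nat p ^ lev l * vec_index (vec K y) l) = c"
      using c(2) y by (intro eq_vecI) simp_all
    then have "v = vec K y \<^sub>v* laurent_mat H" using mult[of "vec K y"] c(1) by simp
    moreover have "vec K y \<in> carrier_vec (dim_row H)" using dims by simp
    ultimately show "v \<in> {u \<^sub>v* laurent_mat H | u. u \<in> carrier_vec (dim_row H)}" by blast
  qed
qed

end

section \<open>The p-dimension is at most r times the number of generators\<close>

context graded_generators
begin

text \<open>
  The polynomial codewords of bounded degree are counted twice: from below by the digit coefficients over
  the rows of \<open>H\<close>, where \<open>p_combination_unique\<close> makes them distinct, and from above by their coefficients over the rows
  of \<open>G\<close>, where \<open>supp_coefficients\<close> shows that they are determined by a truncation.
\<close>

lemma p_dimension_le:
  assumes H: "p_encoder p n code H"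
  shows "dim_row H \<le> r * K"
proof -
  define k where "k = dim_row H"
  have dimH: "dim_col H = n" and basis: "p_basis p n (rows H)" using H by (auto simp: p_encoder_def)
  \<comment> \<open>Multiplication by \<open>H\<close> raises the degree by less than \<open>\<delta>\<close>; the 0 keeps the maximum defined when \<open>H\<close>
    has no entries.\<close>
  define \<delta> where "\<delta> = Suc (Max (insert 0 ((\<lambda>(t, c). degree (index_mat H (t, c))) ` ({..<k} \<times> {..<n}))))"
  have deg: "degree (index_mat H (t, c)) < \<delta>" if "t < k" "c < n" for t c
    using that unfolding \<delta>_def by (intro le_imp_less_Suc Max_ge) auto
  have bound: "k * d \<le> r * (K * (d + \<delta>))" for d
  proof -
    \<comment> \<open>\<open>F\<close> encodes the coefficient vectors of degree less than \<open>d\<close>, \<open>X\<close> the truncated coefficients over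
      the rows of \<open>G\<close>.\<close>
    define F where "F = ({..<k} \<times> {..<d}) \<rightarrow>\<^sub>E {..<p}"
    define X where "X = ({..<K} \<times> {..<d + \<delta>}) \<rightarrow>\<^sub>E (UNIV :: 'q mod_ring set)"
    define a where "a \<phi> t = (\<Sum>i<d. Polynomial.monom (of_nat (\<phi> (t, i)) :: 'q mod_ring) i)" for \<phi> :: "nat \<times> nat \<Rightarrow> nat" and t
    have coeff_a: "poly.coeff (a \<phi> t) i = (if i < d then of_nat (\<phi> (t, i)) else 0)" for \<phi> t i
      by (simp add: a_def coeff_sum)
    have a_digits: "a \<phi> t \<in> digit_polys p" if "\<phi> \<in> F" "t < k" for \<phi> t
    proof -
      have "(of_nat (\<phi> (t, i)) :: 'q mod_ring) \<in> digits p" if "i < d" for i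
        using \<open>\<phi> \<in> F\<close> \<open>t < k\<close> that by (auto simp: F_def digits_def)
      then show ?thesis using p_gt_1 by (simp add: digit_polys_def coeff_a zero_in_digits)
    qed
    define w where "w \<phi> c = (\<Sum>t<k. a \<phi> t * index_mat H (t, c))" for \<phi> c
    have coeff_w: "poly.coeff (w \<phi> c) i = 0" if "c < n" "i \<ge> d + \<delta>" for \<phi> c i
    proof -
      have "poly.coeff (a \<phi> t * index_mat H (t, c)) i = 0" if t: "t < k" for t
      proof (rule coeff_eq_0)
        have "degree (a \<phi> t) \<le> d"
          by (intro degree_le) (simp add: coeff_a)
        moreover have "degree (a \<phi> t * index_mat H (t, c)) \<le> degree (a \<phi> t) + degree (index_mat H (t, c))"
          by (rule degree_mult_le)
        ultimately show "degree (a \<phi> t * index_mat H (t, c)) < i"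
          using deg[OF t \<open>c < n\<close>] \<open>i \<ge> d + \<delta>\<close> by linarith
      qed
      then show ?thesis by (simp add: w_def coeff_sum)
    qed
    have "\<exists>b \<in> carrier_vec K. \<forall>c<n. vec_index (b \<^sub>v* laurent_mat G) c = fls_of_poly (w \<phi> c)"
      if \<phi>: "\<phi> \<in> F" for \<phi>
    proof -
      define u where "u = map_vec fls_of_poly (vec k (a \<phi>))"
      have "fls_nth (fls_of_poly (a \<phi> t)) i \<in> digits p" if "t < k" for t i
        using a_digits[OF \<phi> that] zero_in_digits[of p, where ?'a = "'q mod_ring"] p_gt_1
        by (auto simp: digit_polys_def)
      then have "u \<in> vecs_over (digit_laurent p) (dim_row H)"
        by (auto simp: u_def vecs_over_def vec_set_def digit_laurent_def k_def)
      then have "u \<^sub>v* laurent_mat H \<in> code" using H by (auto simp: p_encoder_def)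
      then obtain b where b: "b \<in> carrier_vec K" "u \<^sub>v* laurent_mat H = b \<^sub>v* laurent_mat G"
        by (auto simp: code_def)
      have "u \<^sub>v* laurent_mat H = map_vec fls_of_poly (vec k (a \<phi>) \<^sub>v* H)"
        unfolding u_def by (subst laurent_vec_mat_mult) (simp_all add: k_def)
      then have "vec_index (u \<^sub>v* laurent_mat H) c = fls_of_poly (w \<phi> c)" if "c < n" for c
        using that dimH by (simp add: w_def index_vec_mat_mult k_def)
      then show ?thesis using b by auto
    qed
    then have "\<forall>\<phi>\<in>F. \<exists>b. b \<in> carrier_vec K \<and>
        (\<forall>c<n. vec_index (b \<^sub>v* laurent_mat G) c = fls_of_poly (w \<phi> c))"
      by blast
    from bchoice[OF this] obtain b where "\<forall>\<phi>\<in>F. b \<phi> \<in> carrier_vec K \<and>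
        (\<forall>c<n. vec_index (b \<phi> \<^sub>v* laurent_mat G) c = fls_of_poly (w \<phi> c))" ..
    then have b: "\<And>\<phi>. \<phi> \<in> F \<Longrightarrow> b \<phi> \<in> carrier_vec K"
      "\<And>\<phi> c. \<phi> \<in> F \<Longrightarrow> c < n \<Longrightarrow> vec_index (b \<phi> \<^sub>v* laurent_mat G) c = fls_of_poly (w \<phi> c)"
      by blast+
    have supp_b: "supp (b \<phi>) \<subseteq> {0..}" if "\<phi> \<in> F" for \<phi>
    proof (rule supp_coefficients[OF rank0])
      show "b \<phi> \<in> carrier_vec K" using b(1) that .
      show "supp (b \<phi> \<^sub>v* laurent_mat G) \<subseteq> {0..}"
        unfolding supp_subset_iff using b(2)[OF that] by simp
    qed
    define \<Psi> where "\<Psi> \<phi> = restrict (\<lambda>(l, i). fls_nth (vec_index (b \<phi>) l) (int i)) ({..<K} \<times> {..<d + \<delta>})" for \<phi>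
    have "inj_on \<Psi> F"
    proof
      fix \<phi> \<psi> assume F: "\<phi> \<in> F" "\<psi> \<in> F" and eq: "\<Psi> \<phi> = \<Psi> \<psi>"
      have nth_eq: "fls_nth (vec_index (b \<phi>) l) i = fls_nth (vec_index (b \<psi>) l) i"
        if "l < K" "i < int (d + \<delta>)" for l i
      proof (cases "i < 0")
        case True
        then show ?thesis using supp_b[OF F(1)] supp_b[OF F(2)] b(1)[OF F(1)] b(1)[OF F(2)] that
          by (simp add: supp_subset_iff)
      next
        case False
        then have "(l, nat i) \<in> {..<K} \<times> {..<d + \<delta>}" using that by auto
        then have "fls_nth (vec_index (b \<phi>) l) (int (nat i)) = fls_nth (vec_index (b \<psi>) l) (int (nat i))"
          using fun_cong[OF eq, of "(l, nat i)"] by (simp add: \<Psi>_def)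
        then show ?thesis using False by simp
      qed
      have diff: "b \<phi> - b \<psi> \<in> carrier_vec K" using b(1) F by simp
      have "supp (b \<phi> - b \<psi>) \<subseteq> {int (d + \<delta>)..}"
        unfolding supp_subset_iff using nth_eq b(1)[OF F(1)] b(1)[OF F(2)] by simp
      then have supp: "supp ((b \<phi> - b \<psi>) \<^sub>v* laurent_mat G) \<subseteq> {int (d + \<delta>)..}"
        using diff by (intro supp_vec_mat_mult)
      have w_eq: "w \<phi> c = w \<psi> c" if c: "c < n" for c
      proof (rule poly_eqI)
        fix i
        have "vec_index ((b \<phi> - b \<psi>) \<^sub>v* laurent_mat G) c
            = vec_index (b \<phi> \<^sub>v* laurent_mat G) c - vec_index (b \<psi> \<^sub>v* laurent_mat G) c"
          using c diff b(1)[OF F(1)] b(1)[OF F(2)]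
          by (simp add: index_vec_mat_mult left_diff_distrib sum_subtractf)
        also have "\<dots> = fls_of_poly (w \<phi> c) - fls_of_poly (w \<psi> c)"
          using b(2) F c by simp
        finally have *: "vec_index ((b \<phi> - b \<psi>) \<^sub>v* laurent_mat G) c = fls_of_poly (w \<phi> c) - fls_of_poly (w \<psi> c)" .
        show "poly.coeff (w \<phi> c) i = poly.coeff (w \<psi> c) i"
        proof (cases "i < d + \<delta>")
          case True
          then have "fls_nth (vec_index ((b \<phi> - b \<psi>) \<^sub>v* laurent_mat G) c) (int i) = 0"
            using supp c by (simp add: supp_subset_iff)
          then show ?thesis unfolding * by simp
        next
          case False
          then show ?thesis using coeff_w[OF c] by simp
        qed
      qed
      have a_eq: "a \<phi> t = a \<psi> t" if "t < k" for t
      proof (rule p_combination_unique[OF basis])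
        show "(\<Sum>i<length (rows H). a \<phi> i * vec_index (rows H ! i) c)
            = (\<Sum>i<length (rows H). a \<psi> i * vec_index (rows H ! i) c)" if "c < n" for c
          using w_eq[OF that] that dimH by (simp add: w_def k_def)
      qed (use that a_digits F in \<open>simp_all add: k_def\<close>)
      show "\<phi> = \<psi>"
      proof (rule PiE_ext)
        show "\<phi> \<in> ({..<k} \<times> {..<d}) \<rightarrow>\<^sub>E {..<p}" "\<psi> \<in> ({..<k} \<times> {..<d}) \<rightarrow>\<^sub>E {..<p}"
          using F by (simp_all add: F_def)
        fix x assume x: "x \<in> {..<k} \<times> {..<d}"
        then obtain t i where ti: "x = (t, i)" "t < k" "i < d" by auto
        have "of_nat (\<phi> x) = (of_nat (\<psi> x) :: 'q mod_ring)"
          using a_eq[OF ti(2)] coeff_a[of \<phi> t i] coeff_a[of \<psi> t i] ti by simp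
        moreover have "\<phi> x < p" "\<psi> x < p"
          using F x by (auto simp: F_def)
        ultimately show "\<phi> x = \<psi> x" by (rule of_nat_inj)
      qed
    qed
    moreover have "\<Psi> ` F \<subseteq> X"
      unfolding \<Psi>_def X_def by (intro image_subsetI) (simp only: restrict_PiE_iff, blast)
    moreover have "finite X" unfolding X_def by (intro finite_PiE) auto
    ultimately have "card F \<le> card X" by (rule card_inj_on_le)
    moreover have "card F = p ^ (k * d)"
      by (simp add: F_def card_PiE)
    moreover have "card X = p ^ (r * (K * (d + \<delta>)))"
      by (simp add: X_def card_PiE card power_mult)
    ultimately show ?thesis using p_gt_1 by simp
  qed
  show ?thesis
  proof (rule ccontr)
    assume "\<not> dim_row H \<le> r * K"
    \<comment> \<open>For \<open>d = r K \<delta> + 1\<close> one row in excess of \<open>r K\<close> already outweighs the constant term \<open>r K \<delta>\<close>.\<close>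
    then have "Suc (r * K) * Suc (r * K * \<delta>) \<le> k * Suc (r * K * \<delta>)"
      unfolding k_def by (intro mult_right_mono) auto
    also have "\<dots> \<le> r * (K * (Suc (r * K * \<delta>) + \<delta>))" by (rule bound)
    finally show False by (simp add: algebra_simps)
  qed
qed

end

section \<open>Information sets\<close>

context prime_power_ring
begin

text \<open>
  The elements killed by \<open>p\<close>, that is, the minimal ideal \<open>p ^ (r - 1) R\<close>. It is a one-dimensional vector
  space over the residue field, and so it makes linear algebra over that field available inside \<open>R\<close>.
\<close>

definition socle :: "'q mod_ring set" where
  "socle = {x. of_nat p * x = 0}"

lemma socle_generated:
  assumes "x \<in> socle" "x \<noteq> 0" "y \<in> socle"
  obtains c where "c * x = y"
proof -
  have *: "\<exists>t. x = of_nat p ^ (r - 1) * t" if "x \<in> socle" for x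
    using that p_power_annihilates[of 1 x] r_pos by (auto simp: socle_def Suc_leI)
  obtain t where t: "x = of_nat p ^ (r - 1) * t" using * assms(1) by blast
  obtain s where s: "y = of_nat p ^ (r - 1) * s" using * assms(3) by blast
  have "\<nexists>z. t = of_nat p * z"
  proof
    assume "\<exists>z. t = of_nat p * z"
    then obtain z where "x = of_nat p ^ (r - 1) * (of_nat p * z)" using t by blast
    also have "\<dots> = of_nat p ^ r * z"
      using r_pos by (cases r) (simp_all add: mult.assoc)
    finally show False using assms(2) by simp
  qed
  then obtain c where "c * t = 1" by (rule unit_if_not_multiple_of_p)
  moreover have "s * c * x = of_nat p ^ (r - 1) * s * (c * t)" by (simp add: t ac_simps)
  ultimately have "s * c * x = y" by (simp add: s)
  then show ?thesis by (rule that)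
qed

lemma card_socle: "card socle > 1"
proof -
  have "of_nat p ^ (r - 1) \<noteq> (0 :: 'q mod_ring)"
    using p_power_eq_0_iff r_pos by simp
  moreover have "of_nat p * of_nat p ^ (r - 1) = (of_nat p ^ r :: 'q mod_ring)"
    using r_pos by (cases r) simp_all
  ultimately have "{0, of_nat p ^ (r - 1)} \<subseteq> socle" "card {0, of_nat p ^ (r - 1) :: 'q mod_ring} = 2"
    by (auto simp: socle_def)
  then show ?thesis using card_mono[of socle "{0, of_nat p ^ (r - 1)}"] by simp
qed

definition socle_kernel :: "'q mod_ring mat \<Rightarrow> nat set \<Rightarrow> 'q mod_ring vec set" where
  "socle_kernel A I = {u \<in> vecs_over socle (dim_row A). \<forall>c \<in> I. vec_index (u \<^sub>v* A) c = 0}"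

lemma smult_add_mem_vecs_over_socle:
  assumes "u \<in> vecs_over socle m" "w \<in> vecs_over socle m"
  shows "a \<cdot>\<^sub>v u + w \<in> vecs_over socle m"
proof -
  have "of_nat p * (a * vec_index u l + vec_index w l) = 0" if "l < m" for l
  proof -
    have "of_nat p * vec_index u l = 0" "of_nat p * vec_index w l = 0"
      using assms that by (auto simp: vecs_over_iff socle_def)
    moreover have "of_nat p * (a * vec_index u l + vec_index w l)
        = a * (of_nat p * vec_index u l) + of_nat p * vec_index w l"
      by (simp add: algebra_simps)
    ultimately show ?thesis by simp
  qed
  then show ?thesis using assms by (auto simp: vecs_over_iff socle_def)
qed

text \<open>
  One more linear condition that does not hold identically divides the number of solutions by the size
  of the socle: its values fill the socle, since every nonzero element of the socle generates it, so the
  old kernel consists of the translates of the new one by multiples of \<open>u\<close>.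
\<close>

lemma card_socle_kernel_insert:
  assumes u: "u \<in> socle_kernel A I" and c: "c < dim_col A" and nz: "vec_index (u \<^sub>v* A) c \<noteq> 0"
    and I: "I \<subseteq> {..<dim_col A}"
  shows "card (socle_kernel A I) = card socle * card (socle_kernel A (insert c I))"
proof -
  have dim: "w \<in> carrier_vec (dim_row A)" if "w \<in> socle_kernel A J" for w J
    using that by (simp add: socle_kernel_def vecs_over_def)
  have img: "vec_index (w \<^sub>v* A) c \<in> socle" if w: "w \<in> socle_kernel A J" for w J
  proof -
    have "of_nat p * vec_index w l = 0" if "l < dim_row A" for l
      using w that by (auto simp: socle_kernel_def vecs_over_iff socle_def)
    then have "of_nat p * (vec_index w l * x) = 0" if "l < dim_row A" for l x
      using that by (metis mult.assoc mult_zero_left)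
    then show ?thesis
      using dim[OF w] c by (simp add: socle_def index_vec_mat_mult sum_distrib_left)
  qed
  have "\<exists>b. b * vec_index (u \<^sub>v* A) c = y" if "y \<in> socle" for y
    using socle_generated[OF img[OF u] nz that] by blast
  then obtain b where b: "\<And>y. y \<in> socle \<Longrightarrow> b y * vec_index (u \<^sub>v* A) c = y" by metis
  have comb: "a \<cdot>\<^sub>v u + w \<in> socle_kernel A I" if "w \<in> socle_kernel A I" for a w
    using that u dim[OF u] dim[OF that] I
    by (auto simp: socle_kernel_def smult_add_mem_vecs_over_socle index_smult_add_vec_mat_mult subset_iff)
  \<comment> \<open>A solution for \<open>I\<close> splits into its value \<open>y\<close> at column \<open>c\<close> and a solution that also vanishes there.\<close>
  define f where "f = (\<lambda>(y, w). b y \<cdot>\<^sub>v u + w)"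
  define g where "g = (\<lambda>w. (vec_index (w \<^sub>v* A) c, - b (vec_index (w \<^sub>v* A) c) \<cdot>\<^sub>v u + w))"
  have gf: "g (f (y, w)) = (y, w)" if y: "y \<in> socle" and w: "w \<in> socle_kernel A (insert c I)" for y w
  proof -
    have "vec_index (w \<^sub>v* A) c = 0" using w by (simp add: socle_kernel_def)
    then have "vec_index ((b y \<cdot>\<^sub>v u + w) \<^sub>v* A) c = y"
      using index_smult_add_vec_mat_mult[OF dim[OF u] dim[OF w] c] b[OF y] by simp
    moreover have "- b y \<cdot>\<^sub>v u + (b y \<cdot>\<^sub>v u + w) = w"
      using dim[OF u] dim[OF w] by (intro eq_vecI) auto
    ultimately show ?thesis by (simp add: f_def g_def)
  qed
  have fg: "f (g w) = w" if w: "w \<in> socle_kernel A I" for w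
    using dim[OF u] dim[OF w] unfolding f_def g_def by (intro eq_vecI) auto
  have f: "f (y, w) \<in> socle_kernel A I" if "w \<in> socle_kernel A (insert c I)" for y w
  proof -
    have "w \<in> socle_kernel A I" using that by (simp add: socle_kernel_def)
    then show ?thesis by (simp add: f_def comb)
  qed
  have g: "g w \<in> socle \<times> socle_kernel A (insert c I)" if w: "w \<in> socle_kernel A I" for w
  proof -
    have "vec_index ((- b (vec_index (w \<^sub>v* A) c) \<cdot>\<^sub>v u + w) \<^sub>v* A) c = 0"
      using index_smult_add_vec_mat_mult[OF dim[OF u] dim[OF w] c] b[OF img[OF w]] by simp
    then show ?thesis
      using img[OF w] comb[OF w] by (simp add: g_def socle_kernel_def)
  qed
  have "bij_betw f (socle \<times> socle_kernel A (insert c I)) (socle_kernel A I)"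
    using gf fg f g by (intro bij_betw_byWitness[where f' = g] image_subsetI ballI) auto
  then have "card (socle \<times> socle_kernel A (insert c I)) = card (socle_kernel A I)"
    by (rule bij_betw_same_card)
  then show ?thesis by (simp add: card_cartesian_product)
qed

text \<open>
  Greedy choice of columns. As long as fewer columns than rows are chosen, the kernel is too large to be
  trivial, and by full row rank some column is nonzero on it.
\<close>

lemma socle_kernel_columns:
  assumes rank: "full_row_rank A" and "m \<le> dim_row A"
  shows "\<exists>I \<subseteq> {..<dim_col A}. card I = m \<and>
    card (socle_kernel A I) * card socle ^ m = card socle ^ dim_row A"
  using assms(2)
proof (induction m)
  case 0
  have "socle_kernel A {} = vecs_over socle (dim_row A)" by (simp add: socle_kernel_def)
  then have "card (socle_kernel A {}) = card socle ^ dim_row A" by (simp add: card_vecs_over)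
  then show ?case by (intro exI[of _ "{}"]) simp
next
  case (Suc m)
  then obtain I where I: "I \<subseteq> {..<dim_col A}" "card I = m"
    "card (socle_kernel A I) * card socle ^ m = card socle ^ dim_row A"
    by auto
  have "socle_kernel A I \<noteq> {0\<^sub>v (dim_row A)}"
  proof
    assume "socle_kernel A I = {0\<^sub>v (dim_row A)}"
    then have "card socle ^ m = card socle ^ dim_row A" using I(3) by simp
    then have "m = dim_row A" using card_socle by simp
    then show False using Suc.prems by simp
  qed
  moreover have "socle_kernel A I \<noteq> {}"
  proof
    assume "socle_kernel A I = {}"
    then have "card socle ^ dim_row A = 0" using I(3) by simp
    then show False using card_socle by simp
  qed
  ultimately obtain u where u: "u \<in> socle_kernel A I" "u \<noteq> 0\<^sub>v (dim_row A)" by blast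
  then have "u \<in> carrier_vec (dim_row A)" by (simp add: socle_kernel_def vecs_over_def)
  then have "u \<^sub>v* A \<noteq> 0\<^sub>v (dim_col A)" using rank u(2) by (auto simp: full_row_rank_def)
  then obtain c where c: "c < dim_col A" "vec_index (u \<^sub>v* A) c \<noteq> 0"
    by (metis dim_vec_mat_mult eq_vecI index_zero_vec)
  then have "c \<notin> I" using u(1) by (auto simp: socle_kernel_def)
  moreover have "finite I" using I(1) finite_subset by blast
  ultimately have "card (insert c I) = Suc m" using I(2) by simp
  moreover have "card (socle_kernel A (insert c I)) * card socle ^ Suc m = card (socle_kernel A I) * card socle ^ m"
    unfolding card_socle_kernel_insert[OF u(1) c I(1)] by simp
  then have "card (socle_kernel A (insert c I)) * card socle ^ Suc m = card socle ^ dim_row A"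
    using I(3) by simp
  moreover have "insert c I \<subseteq> {..<dim_col A}" using I(1) c(1) by simp
  ultimately show ?case by (intro exI[of _ "insert c I"] conjI)
qed

text \<open>
  A nonzero vector in the kernel over \<open>R\<close> would yield one over the socle, by multiplying with the
  highest power of \<open>p\<close> that does not kill it. So it suffices that the kernel over the socle is
  trivial, and there the columns can be counted.
\<close>

lemma information_set:
  fixes A :: "'q mod_ring mat"
  assumes rank: "full_row_rank A"
  obtains I where "I \<subseteq> {..<dim_col A}" "card I = dim_row A"
    and "\<And>u. u \<in> carrier_vec (dim_row A) \<Longrightarrow> (\<And>c. c \<in> I \<Longrightarrow> vec_index (u \<^sub>v* A) c = 0)
      \<Longrightarrow> u = 0\<^sub>v (dim_row A)"
proof -
  obtain I where I: "I \<subseteq> {..<dim_col A}" "card I = dim_row A"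
    "card (socle_kernel A I) * card socle ^ dim_row A = card socle ^ dim_row A"
    using socle_kernel_columns[OF rank, of "dim_row A"] by blast
  then have "card (socle_kernel A I) = 1" using card_socle by auto
  then obtain z where z: "socle_kernel A I = {z}" by (rule card_1_singletonE)
  have trivial: "u = 0\<^sub>v (dim_row A)"
    if u: "u \<in> carrier_vec (dim_row A)" and 0: "\<And>c. c \<in> I \<Longrightarrow> vec_index (u \<^sub>v* A) c = 0" for u
  proof (rule ccontr)
    assume nz: "u \<noteq> 0\<^sub>v (dim_row A)"
    \<comment> \<open>The highest power of \<open>p\<close> that does not kill \<open>u\<close> is \<open>p ^ (s - 1)\<close>.\<close>
    define s where "s = (LEAST s. of_nat p ^ s \<cdot>\<^sub>v u = 0\<^sub>v (dim_row A))"
    have "of_nat p ^ r \<cdot>\<^sub>v u = 0\<^sub>v (dim_row A)" using u by (intro eq_vecI) auto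
    then have s: "of_nat p ^ s \<cdot>\<^sub>v u = 0\<^sub>v (dim_row A)" unfolding s_def by (rule LeastI)
    have "s \<noteq> 0" using s nz u by (metis one_smult_vec power_0)
    then obtain s' where s': "s = Suc s'" by (cases s) auto
    define w where "w = of_nat p ^ s' \<cdot>\<^sub>v u"
    have wnz: "w \<noteq> 0\<^sub>v (dim_row A)"
      using not_less_Least[of s' "\<lambda>s. of_nat p ^ s \<cdot>\<^sub>v u = 0\<^sub>v (dim_row A)"] s'
      by (auto simp: s_def w_def)
    have "of_nat p * vec_index w l = 0" if "l < dim_row A" for l
    proof -
      have "of_nat p * vec_index w l = vec_index (of_nat p ^ s \<cdot>\<^sub>v u) l"
        using that u by (simp add: w_def s' mult.assoc)
      then show ?thesis using s that by simp
    qed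
    then have "w \<in> vecs_over socle (dim_row A)"
      using u by (auto simp: vecs_over_iff socle_def w_def)
    moreover have "vec_index (w \<^sub>v* A) c = 0" if "c \<in> I" for c
      using that 0 I(1) u by (auto simp: w_def index_smult_vec_mat_mult)
    ultimately have "w \<in> socle_kernel A I" by (simp add: socle_kernel_def)
    moreover have "0\<^sub>v (dim_row A) \<in> socle_kernel A I"
      using I(1) by (auto simp: socle_kernel_def vecs_over_iff socle_def index_vec_mat_mult)
    ultimately show False using z wnz by auto
  qed
  show ?thesis using that[OF I(1,2) trivial] by blast
qed

end

section \<open>Inverting the information columns over power series\<close>

text \<open>
  Over a finite ring an injective endomorphism is surjective, so the matrix has a left inverse.
\<close>

lemma det_unit_if_full_row_rank:
  fixes M :: "'a :: {comm_ring_1, finite} mat"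
  assumes M: "M \<in> carrier_mat m m" and rank: "full_row_rank M"
  obtains d where "d * det M = 1"
proof -
  have dims: "dim_row M = m" "dim_col M = m" using M by auto
  have fin: "finite (carrier_vec m :: 'a vec set)"
    using finite_vecs_over[of "UNIV :: 'a set" m] by (simp add: vecs_over_def)
  have "inj_on (\<lambda>u. u \<^sub>v* M) (carrier_vec m)"
  proof
    fix u w assume u: "u \<in> carrier_vec m" and w: "w \<in> carrier_vec m" and eq: "u \<^sub>v* M = w \<^sub>v* M"
    have "(- 1 \<cdot>\<^sub>v u + w) \<^sub>v* M = 0\<^sub>v m"
      using u w eq dims by (intro eq_vecI) (simp_all add: index_smult_add_vec_mat_mult)
    then have "- 1 \<cdot>\<^sub>v u + w = 0\<^sub>v m"
      using rank dims u w by (simp add: full_row_rank_def)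
    then have "vec_index (- 1 \<cdot>\<^sub>v u + w) l = 0" if "l < m" for l
      using that by simp
    then have "vec_index u l = vec_index w l" if "l < m" for l
      using that u w by simp
    then show "u = w" using u w by (intro eq_vecI) simp_all
  qed
  moreover have "(\<lambda>u. u \<^sub>v* M) ` carrier_vec m \<subseteq> carrier_vec m"
    using dims by (intro image_subsetI carrier_vecI) simp
  ultimately have surj: "(\<lambda>u. u \<^sub>v* M) ` carrier_vec m = carrier_vec m"
    using fin by (intro endo_inj_surj)
  have "\<exists>u \<in> carrier_vec m. u \<^sub>v* M = unit_vec m i" for i
    using surj by (metis imageE unit_vec_carrier)
  then obtain u where u: "\<And>i. u i \<in> carrier_vec m" "\<And>i. u i \<^sub>v* M = unit_vec m i" by metis
  define N where "N = mat m m (\<lambda>(i, l). vec_index (u i) l)"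
  have N: "N \<in> carrier_mat m m" by (simp add: N_def)
  have "N * M = 1\<^sub>m m"
  proof (rule eq_matI)
    fix i c assume "i < dim_row (1\<^sub>m m :: 'a mat)" "c < dim_col (1\<^sub>m m :: 'a mat)"
    then have ic: "i < m" "c < m" by auto
    have "index_mat (N * M) (i, c) = vec_index (u i \<^sub>v* M) c"
      using ic dims u(1)[of i]
      by (simp add: N_def index_vec_mat_mult scalar_prod_def lessThan_atLeast0)
    then show "index_mat (N * M) (i, c) = index_mat (1\<^sub>m m) (i, c)"
      using ic u(2) by simp
  qed (use dims N in auto)
  then have "det N * det M = 1" using det_mult[OF N M] by simp
  then show ?thesis by (rule that)
qed

text \<open>
  The determinant has a unit as constant coefficient and is therefore invertible as a power series; the
  row is the first row of the adjugate divided by the determinant.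
\<close>

lemma fps_inverse_row:
  fixes M :: "'a :: comm_ring_1 poly mat"
  assumes M: "M \<in> carrier_mat m m" and d: "d * det (eval0_mat M) = 1" and "0 < m"
  obtains a :: "nat \<Rightarrow> 'a fps"
  where "\<And>c. c < m \<Longrightarrow> (\<Sum>l<m. a l * fps_of_poly (index_mat M (l, c))) = (if c = 0 then 1 else 0)"
proof -
  have "d * fps_nth (fps_of_poly (det M)) 0 = 1"
    using d unfolding comm_ring_hom.hom_det[OF poly_hom.comm_ring_hom_axioms] by (simp add: poly_0_coeff_0)
  then have inv: "fps_left_inverse (fps_of_poly (det M)) d * fps_of_poly (det M) = 1"
    by (rule fps_left_inverse)
  define D where "D = fps_left_inverse (fps_of_poly (det M)) d"
  define a where "a l = D * fps_of_poly (index_mat (adj_mat M) (0, l))" for l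
  have "(\<Sum>l<m. a l * fps_of_poly (index_mat M (l, c))) = (if c = 0 then 1 else 0)" if c: "c < m" for c
  proof -
    have "(\<Sum>l<m. a l * fps_of_poly (index_mat M (l, c)))
        = D * fps_of_poly (\<Sum>l<m. index_mat (adj_mat M) (0, l) * index_mat M (l, c))"
      by (simp add: a_def fps_of_poly_sum fps_of_poly_mult sum_distrib_left mult.assoc)
    also have "(\<Sum>l<m. index_mat (adj_mat M) (0, l) * index_mat M (l, c)) = index_mat (adj_mat M * M) (0, c)"
      using c assms(3) M adj_mat(1)[OF M] by (simp add: scalar_prod_def lessThan_atLeast0)
    also have "\<dots> = (if c = 0 then det M else 0)"
      using c assms(3) M by (simp add: adj_mat(3))
    finally show ?thesis using inv by (simp add: D_def)
  qed
  then show ?thesis by (rule that)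
qed

section \<open>A codeword of small weight\<close>

context graded_generators
begin

lemma information_columns:
  obtains h where "inj_on h {..<K}" "h ` {..<K} \<subseteq> {..<n}"
    and "full_row_rank (eval0_mat (mat K K (\<lambda>(l, c). index_mat G (l, h c))))"
proof -
  obtain I where I: "I \<subseteq> {..<n}" "card I = K"
    and trivial: "\<And>u. u \<in> carrier_vec K \<Longrightarrow> (\<And>c. c \<in> I \<Longrightarrow> vec_index (u \<^sub>v* eval0_mat G) c = 0)
      \<Longrightarrow> u = 0\<^sub>v K"
    using information_set[OF rank0] by (metis index_map_mat(2,3))
  have "finite I" using I(1) finite_subset by blast
  then obtain h where h: "bij_betw h {..<K} I"
    using ex_bij_betw_nat_finite I(2) by (metis lessThan_atLeast0)
  define M where "M = mat K K (\<lambda>(l, c). index_mat G (l, h c))"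
  have "full_row_rank (eval0_mat M)"
    unfolding full_row_rank_def
  proof (intro ballI impI)
    fix u assume "u \<in> carrier_vec (dim_row (eval0_mat M))"
      and zero: "u \<^sub>v* eval0_mat M = 0\<^sub>v (dim_col (eval0_mat M))"
    then have u: "u \<in> carrier_vec K" by (simp add: M_def)
    have "vec_index (u \<^sub>v* eval0_mat G) c = 0" if "c \<in> I" for c
    proof -
      have "c \<in> h ` {..<K}" using h that by (simp add: bij_betw_def)
      then obtain m where m: "m < K" "h m = c" by auto
      have "vec_index (u \<^sub>v* eval0_mat G) c = vec_index (u \<^sub>v* eval0_mat M) m"
        using m that I(1) u by (auto simp: index_vec_mat_mult M_def)
      then show ?thesis using zero m(1) by (simp add: M_def)
    qed
    then show "u = 0\<^sub>v (dim_row (eval0_mat M))" using trivial[OF u] by (simp add: M_def)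
  qed
  moreover have "inj_on h {..<K}" "h ` {..<K} \<subseteq> {..<n}" using h I(1) by (auto simp: bij_betw_def)
  ultimately show ?thesis using that unfolding M_def by blast
qed

text \<open>
  The codeword is \<open>p ^ (r - 1)\<close> times a combination of the rows of \<open>G\<close> that is a unit vector in the \<open>K\<close> information
  columns. Only the other \<open>n - K\<close> columns can contribute to the weight in every degree, and the
  information columns contribute a single 1, in degree 0.
\<close>

lemma light_codeword:
  assumes "K > 0"
  obtains v where "v \<in> code" "supp v \<subseteq> {0..}" "\<not> supp v \<subseteq> {1..}"
    and "truncated_weight j v \<le> (n - K) * Suc j + 1" and "K \<le> n"
proof -
  obtain h where h: "inj_on h {..<K}" "h ` {..<K} \<subseteq> {..<n}"
    and rank: "full_row_rank (eval0_mat (mat K K (\<lambda>(l, c). index_mat G (l, h c))))"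
    by (rule information_columns)
  define M where "M = mat K K (\<lambda>(l, c). index_mat G (l, h c))"
  have M: "M \<in> carrier_mat K K" by (simp add: M_def)
  have "eval0_mat M \<in> carrier_mat K K" "full_row_rank (eval0_mat M)"
    using rank by (simp_all only: M_def map_carrier_mat mat_carrier)
  then obtain d where d: "d * det (eval0_mat M) = 1"
    by (rule det_unit_if_full_row_rank)
  obtain a where a: "\<And>c. c < K \<Longrightarrow>
      (\<Sum>l<K. a l * fps_of_poly (index_mat M (l, c))) = (if c = 0 then 1 else 0)"
    using fps_inverse_row[OF M d assms] by blast
  \<comment> \<open>The factor \<open>p ^ (r - 1)\<close> makes every coefficient divisible by \<open>p ^ lev l\<close>.\<close>
  define x where "x = vec K (\<lambda>l. of_nat p ^ (r - 1) * fps_to_fls (a l))"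
  define v where "v = x \<^sub>v* laurent_mat G"
  have x: "x \<in> carrier_vec K" by (simp add: x_def)
  have hn: "h c < n" if "c < K" for c using h(2) that by auto
  have v_h: "vec_index v (h c) = (if c = 0 then of_nat p ^ (r - 1) else 0)" if c: "c < K" for c
  proof -
    have "vec_index v (h c) = (\<Sum>l<K. of_nat p ^ (r - 1) * fps_to_fls (a l) * fls_of_poly (index_mat M (l, c)))"
      using c hn[OF c] x by (simp add: v_def index_vec_mat_mult) (simp add: x_def M_def)
    also have "\<dots> = of_nat p ^ (r - 1) * (\<Sum>l<K. fps_to_fls (a l * fps_of_poly (index_mat M (l, c))))"
      by (simp add: sum_distrib_left mult.assoc fls_times_fps_to_fls)
    also have "(\<Sum>l<K. fps_to_fls (a l * fps_of_poly (index_mat M (l, c))))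
        = fps_to_fls (\<Sum>l<K. a l * fps_of_poly (index_mat M (l, c)))"
      by (rule fps_to_fls_sum[symmetric])
    finally show ?thesis using a[OF c] by simp
  qed
  have "v \<in> code"
  proof -
    have "of_nat p ^ lev l dvd vec_index x l" if "l < K" for l
      using lev[OF that] that by (auto simp: x_def intro!: dvd_mult2 le_imp_power_dvd)
    then show ?thesis using x unfolding code_def v_def by blast
  qed
  moreover have "supp v \<subseteq> {0..}"
    unfolding v_def using x
    by (intro supp_vec_mat_mult) (simp_all add: supp_subset_iff x_def fls_mult_of_nat_power_nth)
  moreover have "\<not> supp v \<subseteq> {1..}"
  proof
    assume "supp v \<subseteq> {1..}"
    then have "fls_nth (vec_index v (h 0)) 0 = 0"
      using hn[OF assms] by (simp add: supp_subset_iff v_def)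
    then have "of_nat p ^ (r - 1) * (1 :: 'q mod_ring) = 0"
      using v_h[OF assms] fls_mult_of_nat_power_nth[of p "r - 1" "1 :: 'q mod_ring fls" 0] by simp
    then show False using p_power_eq_0_iff[of "r - 1"] r_pos by simp
  qed
  moreover have card_h: "card (h ` {..<K}) = K" using h(1) by (simp add: card_image)
  then have "K \<le> n" using card_mono[OF _ h(2)] by simp
  moreover have "truncated_weight j v \<le> (n - K) * Suc j + 1"
  proof -
    have "hamming_weight (coeff_vec v (int i)) \<le> (n - K) + (if i = 0 then 1 else 0)" for i
    proof -
      let ?J = "if i = 0 then {h 0} else {}"
      have "{c. c < dim_vec (coeff_vec v (int i)) \<and> vec_index (coeff_vec v (int i)) c \<noteq> 0}
          \<subseteq> ({..<n} - h ` {..<K}) \<union> ?J"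
      proof
        fix c assume "c \<in> {c. c < dim_vec (coeff_vec v (int i)) \<and> vec_index (coeff_vec v (int i)) c \<noteq> 0}"
        then have c: "c < n" "fls_nth (vec_index v c) (int i) \<noteq> 0" by (auto simp: coeff_vec_def v_def)
        show "c \<in> ({..<n} - h ` {..<K}) \<union> ?J"
        proof (cases "c \<in> h ` {..<K}")
          case True
          then obtain m where m: "m < K" "c = h m" by auto
          have "m = 0" using c(2) v_h[OF m(1)] m(2) by (auto split: if_splits)
          moreover have "i = 0"
          proof (rule ccontr)
            assume "i \<noteq> 0"
            then have "fls_nth (of_nat p ^ (r - 1) * (1 :: 'q mod_ring fls)) (int i) = 0"
              by (simp only: fls_mult_of_nat_power_nth) simp
            then show False using c(2) v_h[OF m(1)] m(2) \<open>m = 0\<close> by simp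
          qed
          ultimately show ?thesis using m(2) by simp
        qed (use c in auto)
      qed
      then have "hamming_weight (coeff_vec v (int i)) \<le> card (({..<n} - h ` {..<K}) \<union> ?J)"
        unfolding hamming_weight_def by (intro card_mono) auto
      also have "\<dots> \<le> card ({..<n} - h ` {..<K}) + card ?J" by (rule card_Un_le)
      also have "card ({..<n} - h ` {..<K}) = n - K"
        using h(2) card_h by (subst card_Diff_subset) auto
      finally show ?thesis by (simp split: if_splits)
    qed
    then have "truncated_weight j v \<le> (\<Sum>i = 0..j. (n - K) + (if i = 0 then 1 else 0))"
      unfolding truncated_weight_def by (intro sum_mono)
    also have "\<dots> = (n - K) * Suc j + 1"
      by (simp add: sum.distrib)
    finally show ?thesis .
  qed
  ultimately show ?thesis using that by blast
qed

text \<open>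
  Without generators there is no admissible codeword and the column distance is 0 by convention, so a codeword
  of small weight is only needed when \<open>K > 0\<close>.
\<close>

lemma column_distance_le:
  "column_distance p n code j \<le> (n - K) * Suc j + 1 \<and> K \<le> n"
proof -
  define W where "W = {truncated_weight j v | v. v \<in> code \<and> supp v \<subseteq> {0..} \<and> \<not> supp v \<subseteq> {1..}}"
  have dist: "column_distance p n code j = (if W = {} then 0 else Inf W)"
    unfolding column_distance_eq[OF p_encoder_encoder delay_free_encoder]
      encoder_column_distance_code[OF p_encoder_encoder delay_free_encoder] Let_def W_def ..
  show ?thesis
  proof (cases "K = 0")
    case True
    have "supp v \<subseteq> {1..}" if "v \<in> code" for v
      using that True by (auto simp: code_def supp_subset_iff index_vec_mat_mult)
    then have "W = {}" by (auto simp: W_def)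
    then show ?thesis using dist True by simp
  next
    case False
    then obtain v where v: "v \<in> code" "supp v \<subseteq> {0..}" "\<not> supp v \<subseteq> {1..}"
      "truncated_weight j v \<le> (n - K) * Suc j + 1" "K \<le> n"
      using light_codeword[of j] by auto
    then have "truncated_weight j v \<in> W" by (auto simp: W_def)
    then have "Inf W \<le> truncated_weight j v" by (rule wellorder_Inf_le1)
    then show ?thesis using dist v(4,5) \<open>truncated_weight j v \<in> W\<close> by auto
  qed
qed

end

section \<open>The column distance bound\<close>

text \<open>
  Flattens the blocks: each row of the stack is paired with the index of its block.
\<close>

lemma concat_rows_smult:
  "concat (map (\<lambda>i. rows (a i \<cdot>\<^sub>m B i)) is) =
    map2 (\<lambda>i v. a i \<cdot>\<^sub>v v) (concat (map (\<lambda>i. replicate (dim_row (B i)) i) is))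
      (concat (map (\<lambda>i. rows (B i)) is))"
proof (induction "is")
  case (Cons i "is")
  have "rows (a i \<cdot>\<^sub>m B i) = map (\<lambda>v. a i \<cdot>\<^sub>v v) (rows (B i))"
    by (intro nth_equalityI) (simp_all add: rows_def)
  then show ?case
    using Cons by (simp add: zip_append zip_replicate1)
qed simp

theorem corollary20:
  fixes p r n k j :: nat
    and C :: "'q :: nontriv mod_ring fls vec set"
    and B :: "nat \<Rightarrow> 'q mod_ring poly mat"
  assumes "prime p" and "r \<ge> 1" and "CARD('q) = p ^ r"
    and "convolutional_code n C"
    and "has_p_dimension p n C k"
    and "\<And>i. i < r \<Longrightarrow> dim_col (B i) = n"
    and "generator_matrix n C (vstack n (map (\<lambda>i. of_nat (p ^ i) \<cdot>\<^sub>m B i) [0..<r]))"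
    and "full_row_rank (laurent_mat (vstack n (map B [0..<r])))"
    and "full_row_rank (eval0_mat (vstack n (map B [0..<r])))"
  shows "int (column_distance p n C j) \<le> (int n - \<lceil>real k / real r\<rceil>) * (int j + 1) + 1"
proof -
  define G where "G = vstack n (map B [0..<r])"
  define H where "H = vstack n (map (\<lambda>i. of_nat (p ^ i) \<cdot>\<^sub>m B i) [0..<r])"
  define gs where "gs = concat (map (\<lambda>i. rows (B i)) [0..<r])"
  define levs where "levs = concat (map (\<lambda>i. replicate (dim_row (B i)) i) [0..<r])"
  have G: "G = mat_of_rows n gs" by (simp add: G_def vstack_def gs_def comp_def)
  have "concat (map rows (map (\<lambda>i. of_nat (p ^ i) \<cdot>\<^sub>m B i) [0..<r]))
      = map2 (\<lambda>i v. of_nat (p ^ i) \<cdot>\<^sub>v v) levs gs"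
    unfolding gs_def levs_def map_map comp_def by (rule concat_rows_smult)
  then have H: "H = mat_of_rows n (map2 (\<lambda>i v. of_nat (p ^ i) \<cdot>\<^sub>v v) levs gs)"
    unfolding H_def vstack_def by (rule arg_cong)
  have len: "length levs = length gs"
    by (simp add: levs_def gs_def length_concat comp_def)
  have levs: "levs ! l < r" if "l < length gs" for l
  proof -
    have "levs ! l \<in> set levs" using that len by simp
    then show ?thesis by (auto simp: levs_def)
  qed
  have gs: "gs ! l \<in> carrier_vec n" if "l < length gs" for l
  proof -
    have "gs ! l \<in> set gs" using that by simp
    then obtain i where "i < r" "gs ! l \<in> set (rows (B i))" by (auto simp: gs_def)
    then show ?thesis using assms(6)[of i] rows_carrier[of "B i"] by auto
  qed
  have dimG: "dim_row G = length gs" "dim_col G = n" by (simp_all add: G)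
  interpret graded_generators p r "TYPE('q)" G "nth levs"
    using assms levs dimG by unfold_locales (simp_all add: G_def)
  have "code = {u \<^sub>v* laurent_mat H | u. u \<in> carrier_vec (dim_row H)}"
  proof (rule code_eq_scaled_image[symmetric])
    show "dim_row H = dim_row G" "dim_col H = dim_col G" using len dimG by (simp_all add: H)
    show "index_mat H (l, c) = of_nat (p ^ (levs ! l)) * index_mat G (l, c)"
      if "l < dim_row G" "c < dim_col G" for l c
      using that dimG len gs[of l] by (simp add: H G mat_of_rows_index)
  qed
  then have C: "C = code"
    using assms(7) by (simp add: generator_matrix_def H_def)
  obtain E where E: "p_encoder p n C E" "dim_row E = k"
    using assms(5) by (auto simp: has_p_dimension_def)
  then have "k \<le> r * dim_row G" using p_dimension_le[of E] dimG C by simp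
  then have "real k \<le> real (r * dim_row G)" by (simp only: of_nat_le_iff)
  then have "real k / real r \<le> real (dim_row G)"
    using assms(2) by (simp add: divide_le_eq mult.commute)
  then have ceil: "\<lceil>real k / real r\<rceil> \<le> int (dim_row G)" by (simp add: ceiling_le_iff)
  have dist: "column_distance p n C j \<le> (n - dim_row G) * Suc j + 1" "dim_row G \<le> n"
    using column_distance_le[of j] unfolding C dimG(2) by blast+
  have "int (column_distance p n C j) \<le> int ((n - dim_row G) * Suc j + 1)"
    using dist(1) by (simp only: of_nat_le_iff)
  also have "\<dots> = (int n - int (dim_row G)) * (int j + 1) + 1"
    by (simp only: of_nat_add of_nat_mult of_nat_diff[OF dist(2)]) (simp add: add.commute)
  also have "\<dots> \<le> (int n - \<lceil>real k / real r\<rceil>) * (int j + 1) + 1"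
    using ceil by (intro add_right_mono mult_right_mono) simp_all
  finally show ?thesis .
qed

end
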